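(* Let $P$ and $R$ be two general logic programs such that $P\cup R$ is well-typed and $P$ extends $R$, and let $M$ be a complete model of $P\cup R$. Suppose that (1) $P$ is acceptable with respect to a level mapping $|\ |$ and $M$; (2) every well-typed atom defined in $P$ is bounded with respect to $|\ |$; (3) for all well-typed queries $Q$, all LDNF-derivations of $R\cup\{Q\}$ are finite. Then for all well-typed queries $Q$, all LDNF-derivations of $(P\cup R)\cup\{Q\}$ are finite.
   Context: **Programs.** All programs and queries are over a fixed first-order language with at least one constant. A literal is an atom or a negated atom. A (general) clause is $H\leftarrow L_1,\ldots,L_n$ ($n\ge 0$), $H$ an atom, $L_i$ literals. A (general) query is a finite, possibly empty, sequence of literals. A (general) program is a finite set of clauses. $B_P$ is the set of ground atoms whose predicate symbol occurs in $P$; $\mathit{ground}(P)$ is the set of ground instances of clauses of $P$. **LDNF-resolution (leftmost selection rule).** For a program $P$ and a non-empty query $Q=L,\mathbf{L}$: (i) if $L=A$ is an atom, the resolvents of $Q$ are the queries $(\mathbf{B},\mathbf{L})\theta$ for $H\leftarrow\mathbf{B}$ a variant of a clause of $P$ renamed apart from $Q$ and $\theta=\mathrm{mgu}(A,H)$; (ii) if $L=\neg A$ with $A$ ground, a subsidiary LDNF-tree for $P\cup\{A\}$ is constructed; if this tree is finite and finitely failed, $Q$ has the single resolvent $\mathbf{L}$; if it is finite and has a successful branch, $Q$ fails; if its construction diverges, the derivation containing $Q$ is considered infinite; (iii) if $L=\neg A$ with $A$ non-ground, the derivation flounders: it ends (finitely) with no resolvent. A branch is successful if it ends in the empty query; it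 is failed if it ends in a query whose first literal is positive with no resolvent, or negative and ground with a finite subsidiary tree having a successful branch. A tree is finitely failed if it is finite and all its branches are failed. The branches of the LDNF-tree of $P\cup\{Q\}$ are its LDNF-derivations. "All LDNF-derivations of $P\cup\{Q\}$ are finite" means that the interpreter terminates: there is no infinite sequence $Q=Q_0,Q_1,Q_2,\ldots$ where each $Q_{k+1}$ is a resolvent of $Q_k$ or, if $Q_k$ begins with a ground negative literal $\neg A$, the root $A$ of its subsidiary tree. **Types.** A type is a set of terms closed under substitution. Every $n$-ary predicate $p$ has a fixed mode $m_p:\{1,\ldots,n\}\to\{+,-\}$ ($+$ input, $-$ output position) and a fixed assignment $t_p$ of a type to each position. A type judgement $\mathbf{s}:\mathbf{S}\Rightarrow\mathbf{t}:\mathbf{T}$ is true, written $\models\mathbf{s}:\mathbf{S}\Rightarrow\mathbf{t}:\mathbf{T}$, if for all substitutions $\theta$, $\mathbf{s}\theta\in\mathbf{S}$ implies $\mathbf{t}\theta\in\mathbf{T}$ (componentwise). For a literal $L_s$ (positive or negative), $\mathbf{i}_s:\mathbf{I}_s$ and $\mathbf{o}_s:\mathbf{O}_s$ denote the sequences of terms, with the associated types, in its input and output positions. A query $L_1,\ldots,L_n$ is well-typed if for all $j\in\{1,\ldots,n\}$, $\models\mathbf{o}_{j_1}:\mathbf{O}_{j_1},\ldots,\mathbf{o}_{j_k}:\mathbf{O}_{j_k}\Rightarrow\mathbf{i}_j:\mathbf{I}_j$, where $L_{j_1},\ldots,L_{j_k}$ are all the positive literals in $L_1,\ldots,L_{j-1}$.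 A clause $L_0\leftarrow L_1,\ldots,L_n$ is well-typed if for all $j\in\{1,\ldots,n\}$, $\models\mathbf{i}_0:\mathbf{I}_0,\mathbf{o}_{j_1}:\mathbf{O}_{j_1},\ldots,\mathbf{o}_{j_k}:\mathbf{O}_{j_k}\Rightarrow\mathbf{i}_j:\mathbf{I}_j$, where $L_{j_1},\ldots,L_{j_k}$ are all the positive literals in $L_1,\ldots,L_{j-1}$, and moreover $\models\mathbf{i}_0:\mathbf{I}_0,\mathbf{o}_{j_1}:\mathbf{O}_{j_1},\ldots,\mathbf{o}_{j_h}:\mathbf{O}_{j_h}\Rightarrow\mathbf{o}_0:\mathbf{O}_0$, where $L_{j_1},\ldots,L_{j_h}$ are all the positive literals in $L_1,\ldots,L_n$. A program is well-typed if all its clauses are. A well-typed atom is an atom which is well-typed as a one-literal query. **Level mappings, boundedness.** A level mapping for $P$ is a function $|\ |:B_P\to\mathbf{N}$, extended to ground literals by $|\neg A|=|A|$. An atom $A$ is bounded w.r.t. $|\ |$ if $\{|A'| : A' \text{ a ground instance of } A\}$ is finite. **Complete model.** $p$ refers to $q$ if some clause of $P$ has $p$ in its head and $q$ in its body; "depends on" is the reflexive transitive closure of "refers to". $\mathit{Neg}_P$ is the set of relations occurring in a negative literal in a clause of $P$; $\mathit{Neg}^*_P$ is the set of relations on which relations in $\mathit{Neg}_P$ depend; $P^-$ is the set of clauses of $P$ defining relations in $\mathit{Neg}^*_P$. A model $M$ of $P$ is complete if its restriction to the relations in $\mathit{Neg}^*_P$ is a model of Clark's completion $\mathit{comp}(P^-)$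 (with the free equality axioms; a relation in $\mathit{Neg}^*_P$ having no clauses is completed by $\forall \mathbf{x}\,\neg p(\mathbf{x})$). **Acceptability.** Let $|\ |$ be a level mapping for $P$ and $M$ a complete model (here: of the whole program $P\cup R$). $P$ is acceptable w.r.t. $|\ |$ and $M$ if for every clause $A\leftarrow\mathbf{A},B,\mathbf{B}$ in $\mathit{ground}(P)$ (with $B$ a literal and $\mathbf{A},\mathbf{B}$ sequences of literals): if $M\models\mathbf{A}$ then $|A|>|B|$. **Extension.** A relation is defined in $P$ if it occurs in the head of a clause of $P$; an atom is defined in $P$ if its predicate symbol is. $P$ extends $R$ if no relation defined in $P$ occurs in $R$. *)

theory Defs
  imports Main
begin

section \<open>First-order language\<close>

datatype 'f trm = Var nat | Fun 'f "'f trm list"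

datatype ('f, 'p) atom = Atom (pred: 'p) (args: "'f trm list")

datatype ('f, 'p) literal = Pos "('f, 'p) atom" | Neg "('f, 'p) atom"

datatype ('f, 'p) clause = Clause (head: "('f, 'p) atom") (body: "('f, 'p) literal list")

type_synonym ('f, 'p) query = "('f, 'p) literal list"
type_synonym ('f, 'p) program = "('f, 'p) clause set"
type_synonym 'f subst = "nat \<Rightarrow> 'f trm"

text \<open>
  The underlying first-order language is given by the arities of its symbols; \<open>'f\<close> and \<open>'p\<close> are
  exactly its function and predicate symbols. As the datatypes above are unranked, membership in
  the language is expressed by the \<open>wf_\<close> predicates.
\<close>

record ('f, 'p) signature =
  fun_arity :: "'f \<Rightarrow> nat"
  pred_arity :: "'p \<Rightarrow> nat"

definition has_constant :: "('f, 'p) signature \<Rightarrow> bool" where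
  "has_constant \<Sigma> \<longleftrightarrow> (\<exists>c. fun_arity \<Sigma> c = 0)"

fun wf_trm :: "('f, 'p) signature \<Rightarrow> 'f trm \<Rightarrow> bool" where
  "wf_trm \<Sigma> (Var x) \<longleftrightarrow> True"
| "wf_trm \<Sigma> (Fun f ts) \<longleftrightarrow> length ts = fun_arity \<Sigma> f \<and> (\<forall>t \<in> set ts. wf_trm \<Sigma> t)"

definition wf_atom :: "('f, 'p) signature \<Rightarrow> ('f, 'p) atom \<Rightarrow> bool" where
  "wf_atom \<Sigma> A \<longleftrightarrow>
     length (args A) = pred_arity \<Sigma> (pred A) \<and> (\<forall>t \<in> set (args A). wf_trm \<Sigma> t)"

fun atom_of :: "('f, 'p) literal \<Rightarrow> ('f, 'p) atom" where
  "atom_of (Pos A) = A"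
| "atom_of (Neg A) = A"

definition wf_query :: "('f, 'p) signature \<Rightarrow> ('f, 'p) query \<Rightarrow> bool" where
  "wf_query \<Sigma> Q \<longleftrightarrow> (\<forall>L \<in> set Q. wf_atom \<Sigma> (atom_of L))"

definition wf_clause :: "('f, 'p) signature \<Rightarrow> ('f, 'p) clause \<Rightarrow> bool" where
  "wf_clause \<Sigma> C \<longleftrightarrow> wf_atom \<Sigma> (head C) \<and> wf_query \<Sigma> (body C)"

definition wf_program :: "('f, 'p) signature \<Rightarrow> ('f, 'p) program \<Rightarrow> bool" where
  "wf_program \<Sigma> P \<longleftrightarrow> finite P \<and> (\<forall>C \<in> P. wf_clause \<Sigma> C)"

fun vars_trm :: "'f trm \<Rightarrow> nat set" where
  "vars_trm (Var x) = {x}"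
| "vars_trm (Fun f ts) = (\<Union>t \<in> set ts. vars_trm t)"

definition vars_atom :: "('f, 'p) atom \<Rightarrow> nat set" where
  "vars_atom A = (\<Union>t \<in> set (args A). vars_trm t)"

definition vars_query :: "('f, 'p) query \<Rightarrow> nat set" where
  "vars_query Q = (\<Union>L \<in> set Q. vars_atom (atom_of L))"

definition vars_clause :: "('f, 'p) clause \<Rightarrow> nat set" where
  "vars_clause C = vars_atom (head C) \<union> vars_query (body C)"


section \<open>Substitutions and unifiers\<close>

definition wf_subst :: "('f, 'p) signature \<Rightarrow> 'f subst \<Rightarrow> bool" where
  "wf_subst \<Sigma> \<theta> \<longleftrightarrow> (\<forall>x. wf_trm \<Sigma> (\<theta> x))"

fun subst_trm :: "'f subst \<Rightarrow> 'f trm \<Rightarrow> 'f trm" where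
  "subst_trm \<theta> (Var x) = \<theta> x"
| "subst_trm \<theta> (Fun f ts) = Fun f (map (subst_trm \<theta>) ts)"

definition subst_atom :: "'f subst \<Rightarrow> ('f, 'p) atom \<Rightarrow> ('f, 'p) atom" where
  "subst_atom \<theta> A = Atom (pred A) (map (subst_trm \<theta>) (args A))"

fun subst_literal :: "'f subst \<Rightarrow> ('f, 'p) literal \<Rightarrow> ('f, 'p) literal" where
  "subst_literal \<theta> (Pos A) = Pos (subst_atom \<theta> A)"
| "subst_literal \<theta> (Neg A) = Neg (subst_atom \<theta> A)"

definition subst_query :: "'f subst \<Rightarrow> ('f, 'p) query \<Rightarrow> ('f, 'p) query" where
  "subst_query \<theta> Q = map (subst_literal \<theta>) Q"

definition subst_clause :: "'f subst \<Rightarrow> ('f, 'p) clause \<Rightarrow> ('f, 'p) clause" where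
  "subst_clause \<theta> C = Clause (subst_atom \<theta> (head C)) (subst_query \<theta> (body C))"

definition is_mgu ::
  "('f, 'p) signature \<Rightarrow> 'f subst \<Rightarrow> ('f, 'p) atom \<Rightarrow> ('f, 'p) atom \<Rightarrow> bool" where
  "is_mgu \<Sigma> \<theta> A H \<longleftrightarrow>
     wf_subst \<Sigma> \<theta> \<and> subst_atom \<theta> A = subst_atom \<theta> H \<and>
     (\<forall>\<sigma>. wf_subst \<Sigma> \<sigma> \<and> subst_atom \<sigma> A = subst_atom \<sigma> H \<longrightarrow>
        (\<exists>\<delta>. wf_subst \<Sigma> \<delta> \<and> (\<forall>x. \<sigma> x = subst_trm \<delta> (\<theta> x))))"

definition variant :: "('f, 'p) clause \<Rightarrow> ('f, 'p) clause \<Rightarrow> bool" where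
  "variant C' C \<longleftrightarrow> (\<exists>\<rho>. bij \<rho> \<and> C' = subst_clause (\<lambda>x. Var (\<rho> x)) C)"

definition ground_instance ::
  "('f, 'p) signature \<Rightarrow> ('f, 'p) atom \<Rightarrow> ('f, 'p) atom \<Rightarrow> bool" where
  "ground_instance \<Sigma> A' A \<longleftrightarrow>
     vars_atom A' = {} \<and> (\<exists>\<theta>. wf_subst \<Sigma> \<theta> \<and> A' = subst_atom \<theta> A)"

definition ground_program :: "('f, 'p) signature \<Rightarrow> ('f, 'p) program \<Rightarrow> ('f, 'p) program" where
  "ground_program \<Sigma> P =
     {subst_clause \<theta> C | \<theta> C. C \<in> P \<and> wf_subst \<Sigma> \<theta> \<and> vars_clause (subst_clause \<theta> C) = {}}"


section \<open>LDNF-resolution\<close>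

inductive clause_resolvent ::
  "('f, 'p) signature \<Rightarrow> ('f, 'p) program \<Rightarrow> ('f, 'p) query \<Rightarrow> ('f, 'p) query \<Rightarrow> bool"
  for \<Sigma> P where
  "\<lbrakk>C \<in> P; variant C' C; vars_clause C' \<inter> vars_query (Pos A # Ls) = {}; is_mgu \<Sigma> \<theta> A (head C')\<rbrakk>
   \<Longrightarrow> clause_resolvent \<Sigma> P (Pos A # Ls) (subst_query \<theta> (body C' @ Ls))"

datatype outcome = Success | Failure | Floundering

text \<open>
  \<open>ldnf_tree \<Sigma> P Q R\<close>: the LDNF-tree of \<open>P \<union> {Q}\<close> is finite, including the construction of all its
  subsidiary trees, and \<open>R\<close> is the set of outcomes of its branches. Hence the tree is finitely
  failed iff \<open>R = {Failure}\<close>, and has a successful branch iff \<open>Success \<in> R\<close>. If the construction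
  diverges, then no \<open>R\<close> is related to \<open>Q\<close>.

  All variants and all mgus are admitted as children of a node. Up to renaming of variables these
  are finitely many, so the tree is finite iff it has no infinite branch, which is what the
  inductive definition captures. The last rule covers a case in which \<open>Neg A # Ls\<close> is neither
  failed nor has a resolvent, because the subsidiary tree itself flounders.
\<close>

inductive ldnf_tree ::
  "('f, 'p) signature \<Rightarrow> ('f, 'p) program \<Rightarrow> ('f, 'p) query \<Rightarrow> outcome set \<Rightarrow> bool"
  for \<Sigma> P where
  empty: "ldnf_tree \<Sigma> P [] {Success}"
| pos_fail: "(\<nexists>Q. clause_resolvent \<Sigma> P (Pos A # Ls) Q) \<Longrightarrow> ldnf_tree \<Sigma> P (Pos A # Ls) {Failure}"
| pos_step: "\<lbrakk>\<exists>Q. clause_resolvent \<Sigma> P (Pos A # Ls) Q;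
     \<And>Q. clause_resolvent \<Sigma> P (Pos A # Ls) Q \<Longrightarrow> ldnf_tree \<Sigma> P Q (F Q)\<rbrakk>
   \<Longrightarrow> ldnf_tree \<Sigma> P (Pos A # Ls) (\<Union>Q \<in> {Q. clause_resolvent \<Sigma> P (Pos A # Ls) Q}. F Q)"
| neg_nonground: "vars_atom A \<noteq> {} \<Longrightarrow> ldnf_tree \<Sigma> P (Neg A # Ls) {Floundering}"
| neg_step: "\<lbrakk>vars_atom A = {}; ldnf_tree \<Sigma> P [Pos A] {Failure}; ldnf_tree \<Sigma> P Ls R\<rbrakk>
   \<Longrightarrow> ldnf_tree \<Sigma> P (Neg A # Ls) R"
| neg_fail: "\<lbrakk>vars_atom A = {}; ldnf_tree \<Sigma> P [Pos A] R; Success \<in> R\<rbrakk>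
   \<Longrightarrow> ldnf_tree \<Sigma> P (Neg A # Ls) {Failure}"
| neg_flounder: "\<lbrakk>vars_atom A = {}; ldnf_tree \<Sigma> P [Pos A] R; Success \<notin> R; Floundering \<in> R\<rbrakk>
   \<Longrightarrow> ldnf_tree \<Sigma> P (Neg A # Ls) {Floundering}"

definition finitely_failed ::
  "('f, 'p) signature \<Rightarrow> ('f, 'p) program \<Rightarrow> ('f, 'p) query \<Rightarrow> bool" where
  "finitely_failed \<Sigma> P Q \<longleftrightarrow> ldnf_tree \<Sigma> P Q {Failure}"

inductive resolvent ::
  "('f, 'p) signature \<Rightarrow> ('f, 'p) program \<Rightarrow> ('f, 'p) query \<Rightarrow> ('f, 'p) query \<Rightarrow> bool"
  for \<Sigma> P where
  "clause_resolvent \<Sigma> P Q Q' \<Longrightarrow> resolvent \<Sigma> P Q Q'"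
| "\<lbrakk>vars_atom A = {}; finitely_failed \<Sigma> P [Pos A]\<rbrakk> \<Longrightarrow> resolvent \<Sigma> P (Neg A # Ls) Ls"

inductive ldnf_step ::
  "('f, 'p) signature \<Rightarrow> ('f, 'p) program \<Rightarrow> ('f, 'p) query \<Rightarrow> ('f, 'p) query \<Rightarrow> bool"
  for \<Sigma> P where
  "resolvent \<Sigma> P Q Q' \<Longrightarrow> ldnf_step \<Sigma> P Q Q'"
| "vars_atom A = {} \<Longrightarrow> ldnf_step \<Sigma> P (Neg A # Ls) [Pos A]"

definition all_derivations_finite ::
  "('f, 'p) signature \<Rightarrow> ('f, 'p) program \<Rightarrow> ('f, 'p) query \<Rightarrow> bool" where
  "all_derivations_finite \<Sigma> P Q \<longleftrightarrow>
     (\<nexists>S :: nat \<Rightarrow> ('f, 'p) query. S 0 = Q \<and> (\<forall>k. ldnf_step \<Sigma> P (S k) (S (Suc k))))"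


section \<open>Modes, types and well-typedness\<close>

datatype mode = In | Out

definition is_type :: "('f, 'p) signature \<Rightarrow> 'f trm set \<Rightarrow> bool" where
  "is_type \<Sigma> T \<longleftrightarrow>
     (\<forall>t \<in> T. wf_trm \<Sigma> t) \<and> (\<forall>t \<in> T. \<forall>\<theta>. wf_subst \<Sigma> \<theta> \<longrightarrow> subst_trm \<theta> t \<in> T)"

text \<open>Argument positions are counted from 0. Only positions below the arity matter.\<close>

definition type_assignment ::
  "('f, 'p) signature \<Rightarrow> ('p \<Rightarrow> nat \<Rightarrow> 'f trm set) \<Rightarrow> bool" where
  "type_assignment \<Sigma> ty \<longleftrightarrow> (\<forall>p. \<forall>i < pred_arity \<Sigma> p. is_type \<Sigma> (ty p i))"

text \<open>A typed sequence \<open>s : S\<close> is a list of pairs of a term and a type.\<close>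

definition judgement ::
  "('f, 'p) signature \<Rightarrow> ('f trm \<times> 'f trm set) list \<Rightarrow> ('f trm \<times> 'f trm set) list \<Rightarrow> bool" where
  "judgement \<Sigma> ss ts \<longleftrightarrow>
     (\<forall>\<theta>. wf_subst \<Sigma> \<theta> \<longrightarrow>
        (\<forall>(s, S) \<in> set ss. subst_trm \<theta> s \<in> S) \<longrightarrow> (\<forall>(t, T) \<in> set ts. subst_trm \<theta> t \<in> T))"

definition typed_args ::
  "mode \<Rightarrow> ('p \<Rightarrow> nat \<Rightarrow> mode) \<Rightarrow> ('p \<Rightarrow> nat \<Rightarrow> 'f trm set) \<Rightarrow> ('f, 'p) atom
   \<Rightarrow> ('f trm \<times> 'f trm set) list" where
  "typed_args d m ty A =
     [(args A ! i, ty (pred A) i). i \<leftarrow> [0..<length (args A)], m (pred A) i = d]"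

abbreviation "inputs \<equiv> typed_args In"
abbreviation "outputs \<equiv> typed_args Out"

fun positive_outputs ::
  "('p \<Rightarrow> nat \<Rightarrow> mode) \<Rightarrow> ('p \<Rightarrow> nat \<Rightarrow> 'f trm set) \<Rightarrow> ('f, 'p) query
   \<Rightarrow> ('f trm \<times> 'f trm set) list" where
  "positive_outputs m ty [] = []"
| "positive_outputs m ty (Pos A # Ls) = outputs m ty A @ positive_outputs m ty Ls"
| "positive_outputs m ty (Neg A # Ls) = positive_outputs m ty Ls"

definition well_typed_query ::
  "('f, 'p) signature \<Rightarrow> ('p \<Rightarrow> nat \<Rightarrow> mode) \<Rightarrow> ('p \<Rightarrow> nat \<Rightarrow> 'f trm set) \<Rightarrow> ('f, 'p) query
   \<Rightarrow> bool" where
  "well_typed_query \<Sigma> m ty Q \<longleftrightarrow>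
     (\<forall>j < length Q.
        judgement \<Sigma> (positive_outputs m ty (take j Q)) (inputs m ty (atom_of (Q ! j))))"

definition well_typed_clause ::
  "('f, 'p) signature \<Rightarrow> ('p \<Rightarrow> nat \<Rightarrow> mode) \<Rightarrow> ('p \<Rightarrow> nat \<Rightarrow> 'f trm set) \<Rightarrow> ('f, 'p) clause
   \<Rightarrow> bool" where
  "well_typed_clause \<Sigma> m ty C \<longleftrightarrow>
     (\<forall>j < length (body C).
        judgement \<Sigma> (inputs m ty (head C) @ positive_outputs m ty (take j (body C)))
          (inputs m ty (atom_of (body C ! j)))) \<and>
     judgement \<Sigma> (inputs m ty (head C) @ positive_outputs m ty (body C))
       (outputs m ty (head C))"

definition well_typed_program ::
  "('f, 'p) signature \<Rightarrow> ('p \<Rightarrow> nat \<Rightarrow> mode) \<Rightarrow> ('p \<Rightarrow> nat \<Rightarrow> 'f trm set) \<Rightarrow> ('f, 'p) program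
   \<Rightarrow> bool" where
  "well_typed_program \<Sigma> m ty P \<longleftrightarrow> (\<forall>C \<in> P. well_typed_clause \<Sigma> m ty C)"


section \<open>Models and completion\<close>

text \<open>
  Interpretations need not be Herbrand: the domain is an arbitrary (non-empty) type \<open>'d\<close>, on which
  equality is identity. Values on argument lists of the wrong length are irrelevant.
\<close>

record ('f, 'p, 'd) interp =
  fun_int :: "'f \<Rightarrow> 'd list \<Rightarrow> 'd"
  pred_int :: "'p \<Rightarrow> 'd list \<Rightarrow> bool"

fun eval_trm :: "('f, 'p, 'd) interp \<Rightarrow> (nat \<Rightarrow> 'd) \<Rightarrow> 'f trm \<Rightarrow> 'd" where
  "eval_trm M v (Var x) = v x"
| "eval_trm M v (Fun f ts) = fun_int M f (map (eval_trm M v) ts)"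

definition sat_atom ::
  "('f, 'p, 'd) interp \<Rightarrow> (nat \<Rightarrow> 'd) \<Rightarrow> ('f, 'p) atom \<Rightarrow> bool" where
  "sat_atom M v A \<longleftrightarrow> pred_int M (pred A) (map (eval_trm M v) (args A))"

fun sat_literal ::
  "('f, 'p, 'd) interp \<Rightarrow> (nat \<Rightarrow> 'd) \<Rightarrow> ('f, 'p) literal \<Rightarrow> bool" where
  "sat_literal M v (Pos A) \<longleftrightarrow> sat_atom M v A"
| "sat_literal M v (Neg A) \<longleftrightarrow> \<not> sat_atom M v A"

definition sat_query ::
  "('f, 'p, 'd) interp \<Rightarrow> (nat \<Rightarrow> 'd) \<Rightarrow> ('f, 'p) query \<Rightarrow> bool" where
  "sat_query M v Q \<longleftrightarrow> (\<forall>L \<in> set Q. sat_literal M v L)"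

definition models_query :: "('f, 'p, 'd) interp \<Rightarrow> ('f, 'p) query \<Rightarrow> bool" where
  "models_query M Q \<longleftrightarrow> (\<forall>v. sat_query M v Q)"

definition is_model :: "('f, 'p, 'd) interp \<Rightarrow> ('f, 'p) program \<Rightarrow> bool" where
  "is_model M P \<longleftrightarrow> (\<forall>C \<in> P. \<forall>v. sat_query M v (body C) \<longrightarrow> sat_atom M v (head C))"

definition refers_to :: "('f, 'p) program \<Rightarrow> ('p \<times> 'p) set" where
  "refers_to P = {(pred (head C), pred (atom_of L)) | C L. C \<in> P \<and> L \<in> set (body C)}"

definition neg_rels :: "('f, 'p) program \<Rightarrow> 'p set" where
  "neg_rels P = {pred A | A C. C \<in> P \<and> Neg A \<in> set (body C)}"

definition neg_rels_star :: "('f, 'p) program \<Rightarrow> 'p set" where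
  "neg_rels_star P = (refers_to P)\<^sup>* `` neg_rels P"

definition neg_part :: "('f, 'p) program \<Rightarrow> ('f, 'p) program" where
  "neg_part P = {C \<in> P. pred (head C) \<in> neg_rels_star P}"

definition free_equality ::
  "('f, 'p) signature \<Rightarrow> ('f, 'p, 'd) interp \<Rightarrow> bool" where
  "free_equality \<Sigma> M \<longleftrightarrow>
     (\<forall>f ds es. length ds = fun_arity \<Sigma> f \<and> length es = fun_arity \<Sigma> f \<and>
        fun_int M f ds = fun_int M f es \<longrightarrow> ds = es) \<and>
     (\<forall>f g ds es. f \<noteq> g \<and> length ds = fun_arity \<Sigma> f \<and> length es = fun_arity \<Sigma> g \<longrightarrow>
        fun_int M f ds \<noteq> fun_int M g es) \<and>
     (\<forall>v x t. wf_trm \<Sigma> t \<and> x \<in> vars_trm t \<and> t \<noteq> Var x \<longrightarrow> v x \<noteq> eval_trm M v t)"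

text \<open>
  Truth in \<open>M\<close> of the completion of \<open>P\<close>, where \<open>N\<close> is the set of relations of its language. The
  completed definition \<open>\<forall>x. p(x) \<longleftrightarrow> (\<Or>C. \<exists>y. x = s \<and> L\<^sub>1 \<and> \<dots> \<and> L\<^sub>n)\<close>, with \<open>C = p(s) \<leftarrow> L\<^sub>1, \<dots>, L\<^sub>n\<close>
  ranging over the clauses of \<open>P\<close> for \<open>p\<close>, is evaluated for the values \<open>ds\<close> of \<open>x\<close> and the values
  \<open>v\<close> of the clause variables \<open>y\<close>. The empty disjunction gives \<open>\<forall>x. \<not> p(x)\<close>.
\<close>

definition models_completion ::
  "('f, 'p) signature \<Rightarrow> 'p set \<Rightarrow> ('f, 'p, 'd) interp \<Rightarrow> ('f, 'p) program \<Rightarrow> bool" where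
  "models_completion \<Sigma> N M P \<longleftrightarrow>
     free_equality \<Sigma> M \<and>
     (\<forall>p \<in> N. \<forall>ds. length ds = pred_arity \<Sigma> p \<longrightarrow>
        (pred_int M p ds \<longleftrightarrow>
           (\<exists>C \<in> P. pred (head C) = p \<and>
              (\<exists>v. ds = map (eval_trm M v) (args (head C)) \<and> sat_query M v (body C)))))"

text \<open>
  The completed definitions of the relations in \<open>neg_rels_star P\<close> mention only relations in
  \<open>neg_rels_star P\<close>, so their truth in \<open>M\<close> is that in the restriction of \<open>M\<close> to these relations.
\<close>

definition complete_model ::
  "('f, 'p) signature \<Rightarrow> ('f, 'p, 'd) interp \<Rightarrow> ('f, 'p) program \<Rightarrow> bool" where
  "complete_model \<Sigma> M P \<longleftrightarrow>
     is_model M P \<and> models_completion \<Sigma> (neg_rels_star P) M (neg_part P)"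


section \<open>Boundedness, acceptability, extension\<close>

text \<open>
  A level mapping for \<open>P\<close> is rendered as a total function on atoms. The notions below only use its
  values on ground atoms whose predicate symbol occurs in \<open>P\<close>.
\<close>

type_synonym ('f, 'p) level_mapping = "('f, 'p) atom \<Rightarrow> nat"

definition bounded_atom ::
  "('f, 'p) signature \<Rightarrow> ('f, 'p) level_mapping \<Rightarrow> ('f, 'p) atom \<Rightarrow> bool" where
  "bounded_atom \<Sigma> lev A \<longleftrightarrow> finite {lev A' | A'. ground_instance \<Sigma> A' A}"

definition acceptable ::
  "('f, 'p) signature \<Rightarrow> ('f, 'p) program \<Rightarrow> ('f, 'p) level_mapping
   \<Rightarrow> ('f, 'p, 'd) interp \<Rightarrow> bool" where
  "acceptable \<Sigma> P lev M \<longleftrightarrow>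
     (\<forall>A As B Bs. Clause A (As @ B # Bs) \<in> ground_program \<Sigma> P \<longrightarrow> models_query M As \<longrightarrow>
        lev A > lev (atom_of B))"

definition defined_rels :: "('f, 'p) program \<Rightarrow> 'p set" where
  "defined_rels P = {pred (head C) | C. C \<in> P}"

definition occurring_rels :: "('f, 'p) program \<Rightarrow> 'p set" where
  "occurring_rels P = defined_rels P \<union> {pred (atom_of L) | C L. C \<in> P \<and> L \<in> set (body C)}"

definition extends :: "('f, 'p) program \<Rightarrow> ('f, 'p) program \<Rightarrow> bool" where
  "extends P R \<longleftrightarrow> defined_rels P \<inter> occurring_rels R = {}"

end

theory Submission
  imports Defs
begin

text \<open>
  Let \<open>A\<close> be a well-typed atom defined in \<open>P\<close> whose ground instances have level at most \<open>k\<close>.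
  Termination for \<open>A\<close> is shown by induction on \<open>k\<close>. All queries \<open>L\<^sub>1, \<dots>, L\<^sub>n\<close> met below \<open>A\<close> are
  well-typed and such that, for ground \<open>\<sigma>\<close>, a literal \<open>L\<^sub>j \<sigma>\<close> defined in \<open>P\<close> has level below \<open>k\<close> if \<open>M\<close>
  satisfies \<open>(L\<^sub>1, \<dots>, L\<^sub>j\<^sub>-\<^sub>1) \<sigma>\<close>. Acceptability establishes this for the resolvents of \<open>A\<close>.
  Resolving a positive literal preserves it since \<open>M\<close> is a model of the clauses, and removing a negative
  one since finite failure is sound for \<open>comp(P\<^sup>-)\<close>. So the selected literal has either a smaller bound
  or a relation of \<open>R\<close>, and terminates in both cases. For an arbitrary well-typed query, each selected
  atom terminates as well: it is bounded, or not defined in \<open>P\<close>.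

  Since \<open>M\<close> need not be a Herbrand model, soundness of finite failure requires that terms with the same
  value in a model of the free equality axioms have an mgu, through which the valuation factors.
\<close>

section \<open>Substitution and evaluation\<close>

definition subst_comp :: "'f subst \<Rightarrow> 'f subst \<Rightarrow> 'f subst" where
  "subst_comp \<sigma> \<theta> = (\<lambda>x. subst_trm \<sigma> (\<theta> x))"

lemma subst_trm_subst_trm [simp]:
  "subst_trm \<sigma> (subst_trm \<theta> t) = subst_trm (subst_comp \<sigma> \<theta>) t"
  by (induction t) (auto simp: subst_comp_def)

lemma subst_comp_assoc: "subst_comp (subst_comp \<rho> \<sigma>) \<tau> = subst_comp \<rho> (subst_comp \<sigma> \<tau>)"
  by (rule ext) (simp add: subst_comp_def[of _ \<tau>] subst_comp_def[of \<rho> "\<lambda>x. subst_trm \<sigma> (\<tau> x)"])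

lemma subst_atom_subst_atom [simp]:
  "subst_atom \<sigma> (subst_atom \<theta> A) = subst_atom (subst_comp \<sigma> \<theta>) A"
  by (simp add: subst_atom_def)

lemma subst_literal_subst_literal [simp]:
  "subst_literal \<sigma> (subst_literal \<theta> L) = subst_literal (subst_comp \<sigma> \<theta>) L"
  by (cases L) auto

lemma subst_query_subst_query [simp]:
  "subst_query \<sigma> (subst_query \<theta> Q) = subst_query (subst_comp \<sigma> \<theta>) Q"
  by (simp add: subst_query_def)

lemma subst_query_simps [simp]:
  "subst_query \<theta> [] = []"
  "subst_query \<theta> (L # Q) = subst_literal \<theta> L # subst_query \<theta> Q"
  "subst_query \<theta> (Q @ Q') = subst_query \<theta> Q @ subst_query \<theta> Q'"
  "length (subst_query \<theta> Q) = length Q"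
  by (auto simp: subst_query_def)

lemma head_body_subst_clause [simp]:
  "head (subst_clause \<theta> C) = subst_atom \<theta> (head C)"
  "body (subst_clause \<theta> C) = subst_query \<theta> (body C)"
  by (auto simp: subst_clause_def)

lemma pred_subst_atom [simp]: "pred (subst_atom \<theta> A) = pred A"
  by (simp add: subst_atom_def)

lemma atom_of_subst_literal [simp]: "atom_of (subst_literal \<theta> L) = subst_atom \<theta> (atom_of L)"
  by (cases L) auto

lemma subst_trm_cong: "(\<And>x. x \<in> vars_trm t \<Longrightarrow> \<sigma> x = \<tau> x) \<Longrightarrow> subst_trm \<sigma> t = subst_trm \<tau> t"
  by (induction t) auto

lemma subst_trm_Var [simp]: "subst_trm Var t = t"
  by (induction t) (auto intro: map_idI)

lemma wf_subst_Var [simp]: "wf_subst \<Sigma> Var"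
  by (simp add: wf_subst_def)

lemma wf_trm_subst: "wf_subst \<Sigma> \<theta> \<Longrightarrow> wf_trm \<Sigma> t \<Longrightarrow> wf_trm \<Sigma> (subst_trm \<theta> t)"
  by (induction t) (auto simp: wf_subst_def)

lemma wf_subst_comp: "wf_subst \<Sigma> \<sigma> \<Longrightarrow> wf_subst \<Sigma> \<theta> \<Longrightarrow> wf_subst \<Sigma> (subst_comp \<sigma> \<theta>)"
  by (simp add: wf_subst_def subst_comp_def wf_trm_subst)

lemma wf_atom_subst: "wf_subst \<Sigma> \<theta> \<Longrightarrow> wf_atom \<Sigma> A \<Longrightarrow> wf_atom \<Sigma> (subst_atom \<theta> A)"
  by (auto simp: wf_atom_def subst_atom_def wf_trm_subst)

lemma wf_query_subst: "wf_subst \<Sigma> \<theta> \<Longrightarrow> wf_query \<Sigma> Q \<Longrightarrow> wf_query \<Sigma> (subst_query \<theta> Q)"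
  by (auto simp: wf_query_def subst_query_def wf_atom_subst)

lemma wf_query_simps [simp]:
  "wf_query \<Sigma> []"
  "wf_query \<Sigma> (L # Q) \<longleftrightarrow> wf_atom \<Sigma> (atom_of L) \<and> wf_query \<Sigma> Q"
  "wf_query \<Sigma> (Q @ Q') \<longleftrightarrow> wf_query \<Sigma> Q \<and> wf_query \<Sigma> Q'"
  by (auto simp: wf_query_def)

lemma vars_subst_trm: "vars_trm (subst_trm \<theta> t) = (\<Union>x \<in> vars_trm t. vars_trm (\<theta> x))"
  by (induction t) auto

lemma finite_vars_trm [simp]: "finite (vars_trm t)"
  by (induction t) auto

lemma finite_vars_atom [simp]: "finite (vars_atom A)"
  by (simp add: vars_atom_def)

lemma finite_vars_query [simp]: "finite (vars_query Q)"
  by (simp add: vars_query_def)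

lemma finite_vars_clause [simp]: "finite (vars_clause C)"
  by (simp add: vars_clause_def)

lemma vars_subst_atom: "vars_atom (subst_atom \<theta> A) = (\<Union>x \<in> vars_atom A. vars_trm (\<theta> x))"
  by (auto simp: vars_atom_def subst_atom_def vars_subst_trm)

lemma vars_subst_query: "vars_query (subst_query \<theta> Q) = (\<Union>x \<in> vars_query Q. vars_trm (\<theta> x))"
  by (auto simp: vars_query_def subst_query_def vars_subst_atom)

lemma vars_subst_clause: "vars_clause (subst_clause \<theta> C) = (\<Union>x \<in> vars_clause C. vars_trm (\<theta> x))"
  by (auto simp: vars_clause_def vars_subst_atom vars_subst_query)

section \<open>Evaluation of instances, and its dependence on the occurring variables only\<close>

lemma eval_subst_trm [simp]:
  "eval_trm M v (subst_trm \<theta> t) = eval_trm M (\<lambda>x. eval_trm M v (\<theta> x)) t"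
proof (induction t)
  case (Fun f ts)
  then show ?case by (simp add: comp_def cong: map_cong)
qed simp

lemma sat_subst_atom [simp]:
  "sat_atom M v (subst_atom \<theta> A) \<longleftrightarrow> sat_atom M (\<lambda>x. eval_trm M v (\<theta> x)) A"
  by (simp add: sat_atom_def subst_atom_def comp_def)

lemma sat_subst_literal [simp]:
  "sat_literal M v (subst_literal \<theta> L) \<longleftrightarrow> sat_literal M (\<lambda>x. eval_trm M v (\<theta> x)) L"
  by (cases L) auto

lemma sat_subst_query [simp]:
  "sat_query M v (subst_query \<theta> Q) \<longleftrightarrow> sat_query M (\<lambda>x. eval_trm M v (\<theta> x)) Q"
  by (simp add: sat_query_def subst_query_def)

lemma sat_query_simps [simp]:
  "sat_query M v []"
  "sat_query M v (L # Q) \<longleftrightarrow> sat_literal M v L \<and> sat_query M v Q"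
  "sat_query M v (Q @ Q') \<longleftrightarrow> sat_query M v Q \<and> sat_query M v Q'"
  by (auto simp: sat_query_def)

lemma eval_trm_cong: "(\<And>x. x \<in> vars_trm t \<Longrightarrow> v x = w x) \<Longrightarrow> eval_trm M v t = eval_trm M w t"
proof (induction t)
  case (Fun f ts)
  then have "map (eval_trm M v) ts = map (eval_trm M w) ts" by auto
  then show ?case by (metis eval_trm.simps(2))
qed simp

lemma map_eval_cong:
  assumes "\<And>x. x \<in> vars_atom A \<Longrightarrow> v x = w x"
  shows "map (eval_trm M v) (args A) = map (eval_trm M w) (args A)"
  using assms by (auto simp: vars_atom_def intro!: eval_trm_cong)

lemma sat_atom_cong:
  "(\<And>x. x \<in> vars_atom A \<Longrightarrow> v x = w x) \<Longrightarrow> sat_atom M v A \<longleftrightarrow> sat_atom M w A"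
  unfolding sat_atom_def by (metis map_eval_cong)

lemma sat_literal_cong:
  "(\<And>x. x \<in> vars_atom (atom_of L) \<Longrightarrow> v x = w x) \<Longrightarrow> sat_literal M v L \<longleftrightarrow> sat_literal M w L"
  using sat_atom_cong[of "atom_of L" v w M] by (cases L) auto

lemma sat_query_cong:
  assumes "\<And>x. x \<in> vars_query Q \<Longrightarrow> v x = w x"
  shows "sat_query M v Q \<longleftrightarrow> sat_query M w Q"
proof -
  have "sat_literal M v L \<longleftrightarrow> sat_literal M w L" if "L \<in> set Q" for L
    by (rule sat_literal_cong) (use assms that in \<open>auto simp: vars_query_def\<close>)
  then show ?thesis by (simp add: sat_query_def)
qed


section \<open>Unification in models of the free equality axioms\<close>

definition eqs_wf :: "('f, 'p) signature \<Rightarrow> ('f trm \<times> 'f trm) list \<Rightarrow> bool" where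
  "eqs_wf \<Sigma> E \<longleftrightarrow> (\<forall>(s, t) \<in> set E. wf_trm \<Sigma> s \<and> wf_trm \<Sigma> t)"

definition eqs_vars :: "('f trm \<times> 'f trm) list \<Rightarrow> nat set" where
  "eqs_vars E = (\<Union>(s, t) \<in> set E. vars_trm s \<union> vars_trm t)"

definition eqs_subst :: "'f subst \<Rightarrow> ('f trm \<times> 'f trm) list \<Rightarrow> ('f trm \<times> 'f trm) list" where
  "eqs_subst \<theta> E = map (\<lambda>(s, t). (subst_trm \<theta> s, subst_trm \<theta> t)) E"

definition eqs_sat :: "('f, 'p, 'd) interp \<Rightarrow> (nat \<Rightarrow> 'd) \<Rightarrow> ('f trm \<times> 'f trm) list \<Rightarrow> bool" where
  "eqs_sat M v E \<longleftrightarrow> (\<forall>(s, t) \<in> set E. eval_trm M v s = eval_trm M v t)"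

definition unifies :: "'f subst \<Rightarrow> ('f trm \<times> 'f trm) list \<Rightarrow> bool" where
  "unifies \<theta> E \<longleftrightarrow> (\<forall>(s, t) \<in> set E. subst_trm \<theta> s = subst_trm \<theta> t)"

definition eqs_mgu ::
  "('f, 'p) signature \<Rightarrow> 'f subst \<Rightarrow> ('f trm \<times> 'f trm) list \<Rightarrow> bool" where
  "eqs_mgu \<Sigma> \<theta> E \<longleftrightarrow> wf_subst \<Sigma> \<theta> \<and> unifies \<theta> E \<and>
     (\<forall>\<sigma>. wf_subst \<Sigma> \<sigma> \<and> unifies \<sigma> E \<longrightarrow> (\<exists>\<delta>. wf_subst \<Sigma> \<delta> \<and> \<sigma> = subst_comp \<delta> \<theta>))"

text \<open>Second component of the termination measure for unification. No term has size 0, so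
  deleting a trivial equation decreases the total.\<close>

fun trm_size :: "'f trm \<Rightarrow> nat" where
  "trm_size (Var x) = 1"
| "trm_size (Fun f ts) = Suc (sum_list (map trm_size ts))"

definition eqs_size :: "('f trm \<times> 'f trm) list \<Rightarrow> nat" where
  "eqs_size E = sum_list (map (\<lambda>(s, t). trm_size s + trm_size t) E)"

lemma finite_eqs_vars [simp]: "finite (eqs_vars E)"
  by (auto simp: eqs_vars_def)

lemma eqs_size_zip:
  "length ss = length ts \<Longrightarrow>
   eqs_size (zip ss ts) = sum_list (map trm_size ss) + sum_list (map trm_size ts)"
  by (induction ss ts rule: list_induct2) (auto simp: eqs_size_def)

lemma trm_size_ge_1: "1 \<le> trm_size t"
  by (cases t) auto

lemma unifies_eqs_subst: "unifies \<sigma> (eqs_subst \<theta> E) \<longleftrightarrow> unifies (subst_comp \<sigma> \<theta>) E"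
  by (auto simp: unifies_def eqs_subst_def)

lemma unifies_zip:
  "length ss = length ts \<Longrightarrow>
   unifies \<theta> (zip ss ts) \<longleftrightarrow> map (subst_trm \<theta>) ss = map (subst_trm \<theta>) ts"
  by (induction ss ts rule: list_induct2) (auto simp: unifies_def)

lemma eqs_sat_zip:
  "length ss = length ts \<Longrightarrow>
   eqs_sat M v (zip ss ts) \<longleftrightarrow> map (eval_trm M v) ss = map (eval_trm M v) ts"
  by (induction ss ts rule: list_induct2) (auto simp: eqs_sat_def)

lemma eqs_mgu_equiv: "(\<And>\<sigma>. unifies \<sigma> E \<longleftrightarrow> unifies \<sigma> E') \<Longrightarrow> eqs_mgu \<Sigma> \<theta> E \<longleftrightarrow> eqs_mgu \<Sigma> \<theta> E'"
  by (simp add: eqs_mgu_def)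

text \<open>Every unifier \<sigma> of \<open>Var x\<close> and \<open>t\<close> absorbs the binding:
  applying \<open>x := t\<close> first and then \<sigma> is just \<sigma>. Hence \<sigma> also
  unifies the instantiated equations and factors through \<theta>.\<close>

lemma eqs_mgu_eliminate:
  assumes "wf_trm \<Sigma> t" "x \<notin> vars_trm t" "eqs_mgu \<Sigma> \<theta> (eqs_subst (Var(x := t)) E)"
  shows "eqs_mgu \<Sigma> (subst_comp \<theta> (Var(x := t))) ((Var x, t) # E)"
proof -
  let ?e = "Var(x := t)"
  have "subst_trm ?e t = subst_trm Var t"
    by (rule subst_trm_cong) (use assms(2) in auto)
  then have fix_t: "subst_trm ?e t = t" by simp
  have wf_e: "wf_subst \<Sigma> ?e" using assms(1) by (simp add: wf_subst_def)
  have absorb: "subst_comp \<sigma> ?e = \<sigma>" if "\<sigma> x = subst_trm \<sigma> t" for \<sigma>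
    using that by (auto simp: subst_comp_def)
  have "subst_comp \<theta> ?e x = subst_trm \<theta> t" by (simp add: subst_comp_def)
  moreover have "subst_trm (subst_comp \<theta> ?e) t = subst_trm \<theta> t"
    using subst_trm_subst_trm[of \<theta> ?e t] by (simp only: fix_t)
  moreover have "unifies (subst_comp \<theta> ?e) E"
    using assms(3) by (simp add: eqs_mgu_def unifies_eqs_subst)
  ultimately have "unifies (subst_comp \<theta> ?e) ((Var x, t) # E)"
    by (simp add: unifies_def)
  moreover have "\<exists>\<delta>. wf_subst \<Sigma> \<delta> \<and> \<sigma> = subst_comp \<delta> (subst_comp \<theta> ?e)"
    if "wf_subst \<Sigma> \<sigma>" "unifies \<sigma> ((Var x, t) # E)" for \<sigma>
  proof -
    have \<sigma>: "subst_comp \<sigma> ?e = \<sigma>" using that(2) by (intro absorb) (simp add: unifies_def)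
    have "unifies \<sigma> E" using that(2) by (simp add: unifies_def)
    then have "unifies \<sigma> (eqs_subst ?e E)" by (simp only: unifies_eqs_subst \<sigma>)
    then have "\<exists>\<delta>. wf_subst \<Sigma> \<delta> \<and> \<sigma> = subst_comp \<delta> \<theta>"
      using assms(3) that(1) by (simp add: eqs_mgu_def)
    then obtain \<delta> where wf_\<delta>: "wf_subst \<Sigma> \<delta>" and \<delta>: "\<sigma> = subst_comp \<delta> \<theta>" by blast
    have "\<sigma> = subst_comp \<delta> (subst_comp \<theta> ?e)"
      by (simp only: subst_comp_assoc[symmetric] \<delta>[symmetric] \<sigma>)
    with wf_\<delta> show ?thesis by blast
  qed
  ultimately show ?thesis
    using assms(3) wf_e by (simp add: eqs_mgu_def wf_subst_comp)
qed

text \<open>Unification is run on equations true under \<open>v\<close>. The axioms exclude clash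
  and occurs-check failure, so the run ends with an mgu, and each binding made is already true under
  \<open>v\<close>, so \<open>v\<close> factors through it. The measure is the number of variables,
  then the size.\<close>

lemma free_equality_mgu:
  assumes "free_equality \<Sigma> M" "eqs_wf \<Sigma> E" "eqs_sat M v E"
  shows "\<exists>\<theta> w. eqs_mgu \<Sigma> \<theta> E \<and> v = (\<lambda>x. eval_trm M w (\<theta> x))"
  using assms(2,3)
proof (induction E rule: wf_induct_rule[OF wf_measures[of "[\<lambda>E. card (eqs_vars E), eqs_size]"]])
  case (1 E)
  note IH = "1.IH"
  \<comment> \<open>Stated up to equivalence of unifiers, so that it serves for a variable on either
    side of the first equation.\<close>
  have eliminate: "\<exists>\<theta> w. eqs_mgu \<Sigma> \<theta> E \<and> v = (\<lambda>x. eval_trm M w (\<theta> x))"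
    if x: "x \<notin> vars_trm t" and t: "wf_trm \<Sigma> t" "v x = eval_trm M v t"
      and E': "eqs_wf \<Sigma> E'" "eqs_sat M v E'"
      and vars: "eqs_vars E = insert x (vars_trm t \<union> eqs_vars E')"
      and equiv: "\<And>\<sigma>. unifies \<sigma> E \<longleftrightarrow> unifies \<sigma> ((Var x, t) # E')" for x t E'
  proof -
    let ?e = "Var(x := t)"
    have v: "(\<lambda>y. eval_trm M v (?e y)) = v" using t(2) by auto
    \<comment> \<open>The binding removes \<open>x\<close> and introduces only variables of
      \<open>t\<close>, which occur in \<open>E\<close> already.\<close>
    have "eqs_vars (eqs_subst ?e E') \<subseteq> eqs_vars E - {x}"
      using x vars by (fastforce simp: eqs_vars_def eqs_subst_def vars_subst_trm split: if_splits)
    then have "eqs_vars (eqs_subst ?e E') \<subset> eqs_vars E" using vars by blast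
    then have "card (eqs_vars (eqs_subst ?e E')) < card (eqs_vars E)"
      by (simp add: psubset_card_mono)
    moreover have "eqs_wf \<Sigma> (eqs_subst ?e E')"
      using E'(1) t(1) by (auto simp: eqs_wf_def eqs_subst_def wf_subst_def intro!: wf_trm_subst)
    moreover have "eqs_sat M v (eqs_subst ?e E')"
      using E'(2) v by (auto simp: eqs_sat_def eqs_subst_def)
    ultimately obtain \<theta> w where \<theta>: "eqs_mgu \<Sigma> \<theta> (eqs_subst ?e E')"
      and w: "v = (\<lambda>y. eval_trm M w (\<theta> y))"
      using IH[of "eqs_subst ?e E'"] by auto
    have "eqs_mgu \<Sigma> (subst_comp \<theta> ?e) E"
      using eqs_mgu_eliminate[OF t(1) x \<theta>] eqs_mgu_equiv[OF equiv] by blast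
    moreover have "v = (\<lambda>y. eval_trm M w (subst_comp \<theta> ?e y))"
      using v by (simp add: subst_comp_def w[symmetric] del: fun_upd_apply)
    ultimately show ?thesis by blast
  qed
  have occurs: "t = Var x" if "wf_trm \<Sigma> t" "x \<in> vars_trm t" "v x = eval_trm M v t" for x t
    using assms(1) that unfolding free_equality_def by blast
  show ?case
  proof (cases E)
    case Nil
    have "eqs_mgu \<Sigma> Var E" using Nil by (auto simp: eqs_mgu_def unifies_def subst_comp_def)
    then show ?thesis by (intro exI[of _ Var] exI[of _ v]) auto
  next
    case (Cons st E')
    obtain s t where st: "st = (s, t)" by (cases st)
    have wf: "wf_trm \<Sigma> s" "wf_trm \<Sigma> t" "eqs_wf \<Sigma> E'" and eq: "eval_trm M v s = eval_trm M v t"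
      and sat: "eqs_sat M v E'"
      using "1.prems" Cons st by (auto simp: eqs_wf_def eqs_sat_def)
    have vars: "eqs_vars E = vars_trm s \<union> vars_trm t \<union> eqs_vars E'"
      using Cons st by (auto simp: eqs_vars_def)
    show ?thesis
    proof (cases "s = t")
      case True
      have "eqs_vars E' \<subseteq> eqs_vars E" using vars by blast
      then have "card (eqs_vars E') \<le> card (eqs_vars E)" by (simp add: card_mono)
      moreover have "eqs_size E' < eqs_size E" using Cons st trm_size_ge_1[of s] by (simp add: eqs_size_def)
      ultimately have "(E', E) \<in> measures [\<lambda>E. card (eqs_vars E), eqs_size]" by auto
      then obtain \<theta> w where "eqs_mgu \<Sigma> \<theta> E'" "v = (\<lambda>y. eval_trm M w (\<theta> y))"
        using IH wf(3) sat by blast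
      moreover have "eqs_mgu \<Sigma> \<theta> E \<longleftrightarrow> eqs_mgu \<Sigma> \<theta> E'" for \<theta>
        by (rule eqs_mgu_equiv) (simp add: Cons st True unifies_def)
      ultimately show ?thesis by blast
    next
      case False
      show ?thesis
      proof (cases s)
        case (Var x)
        with False eq wf(2) have "x \<notin> vars_trm t" using occurs[of t x] by auto
        then show ?thesis
          by (rule eliminate[of x t E']) (use Var wf eq sat vars Cons st in \<open>auto simp: unifies_def\<close>)
      next
        case s: (Fun f ss)
        show ?thesis
        proof (cases t)
          case (Var x)
          with False eq wf(1) have "x \<notin> vars_trm s" using occurs[of s x] by auto
          then show ?thesis
            by (rule eliminate[of x s E'])
              (use Var wf eq sat vars Cons st in \<open>auto simp: unifies_def\<close>)
        next
          case t: (Fun g ts)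
          have len: "length ss = fun_arity \<Sigma> f" "length ts = fun_arity \<Sigma> g"
            using wf s t by auto
          have ev: "fun_int M f (map (eval_trm M v) ss) = fun_int M g (map (eval_trm M v) ts)"
            using eq s t by simp
          have "f = g"
            using assms(1) len ev unfolding free_equality_def by (metis length_map)
          then have len': "length ss = length ts" using len by simp
          have args: "map (eval_trm M v) ss = map (eval_trm M v) ts"
            using assms(1) len ev \<open>f = g\<close> unfolding free_equality_def by (metis length_map)
          \<comment> \<open>Decomposition keeps the variables within those of \<open>E\<close> and
            removes two function symbols, so the second measure decreases.\<close>
          let ?E = "zip ss ts @ E'"
          have "eqs_vars (zip ss ts) \<subseteq> vars_trm s \<union> vars_trm t"
            unfolding s t by (auto simp: eqs_vars_def) (meson set_zip_leftD set_zip_rightD)+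
          then have "eqs_vars ?E \<subseteq> eqs_vars E"
            using vars by (auto simp: eqs_vars_def)
          then have "card (eqs_vars ?E) \<le> card (eqs_vars E)" by (simp add: card_mono)
          moreover have "eqs_size ?E < eqs_size E"
            using eqs_size_zip[OF len'] Cons st s t
            by (simp add: eqs_size_def)
          ultimately have "(?E, E) \<in> measures [\<lambda>E. card (eqs_vars E), eqs_size]" by auto
          moreover have "eqs_wf \<Sigma> ?E"
            using wf s t by (auto simp: eqs_wf_def dest: set_zip_leftD set_zip_rightD)
          moreover have "eqs_sat M v ?E"
            using sat args eqs_sat_zip[OF len', of M v] by (auto simp: eqs_sat_def)
          ultimately obtain \<theta> w where "eqs_mgu \<Sigma> \<theta> ?E" "v = (\<lambda>y. eval_trm M w (\<theta> y))"
            using IH by blast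
          moreover have "eqs_mgu \<Sigma> \<theta> E \<longleftrightarrow> eqs_mgu \<Sigma> \<theta> ?E" for \<theta>
          proof (rule eqs_mgu_equiv)
            show "unifies \<sigma> E \<longleftrightarrow> unifies \<sigma> ?E" for \<sigma>
              using unifies_zip[OF len', of \<sigma>] Cons st s t \<open>f = g\<close>
              by (auto simp: unifies_def)
          qed
          ultimately show ?thesis by blast
        qed
      qed
    qed
  qed
qed

lemma free_equality_atom_mgu:
  assumes "free_equality \<Sigma> M" "wf_atom \<Sigma> A" "wf_atom \<Sigma> H" "pred A = pred H"
    and "map (eval_trm M v) (args A) = map (eval_trm M v) (args H)"
  shows "\<exists>\<theta> w. is_mgu \<Sigma> \<theta> A H \<and> v = (\<lambda>x. eval_trm M w (\<theta> x))"
proof -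
  let ?E = "zip (args A) (args H)"
  have len: "length (args A) = length (args H)"
    using assms by (simp add: wf_atom_def)
  have "eqs_wf \<Sigma> ?E"
    using assms by (auto simp: eqs_wf_def wf_atom_def dest: set_zip_leftD set_zip_rightD)
  moreover have "eqs_sat M v ?E"
    using assms(5) eqs_sat_zip[OF len] by blast
  ultimately obtain \<theta> w where "eqs_mgu \<Sigma> \<theta> ?E" "v = (\<lambda>x. eval_trm M w (\<theta> x))"
    using free_equality_mgu[OF assms(1)] by blast
  moreover have "unifies \<sigma> ?E \<longleftrightarrow> subst_atom \<sigma> A = subst_atom \<sigma> H" for \<sigma>
    using unifies_zip[OF len] assms(4) by (simp add: subst_atom_def)
  ultimately show ?thesis
    unfolding is_mgu_def eqs_mgu_def fun_eq_iff subst_comp_def by blast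
qed


section \<open>Soundness of LDNF-resolution in complete models\<close>

text \<open>With \<open>n\<close> above all variables of both sets, \<rho> swaps the blocks below
  \<open>n\<close> and from \<open>n\<close> to \<open>2 * n - 1\<close>. Being an involution, it
  also serves as its own inverse when valuations are transported.\<close>

lemma renaming_apart:
  fixes V W :: "nat set"
  assumes "finite V" "finite W"
  obtains \<rho> where "bij \<rho>" "\<And>x. \<rho> (\<rho> x) = x" "\<rho> ` W \<inter> V = {}"
proof -
  obtain n where n: "\<forall>x \<in> V \<union> W. x < n"
    using assms finite_nat_set_iff_bounded[of "V \<union> W"] by auto
  define \<rho> where "\<rho> x = (if x < n then x + n else if x < 2 * n then x - n else x)" for x
  have inv: "\<rho> (\<rho> x) = x" for x by (auto simp: \<rho>_def)
  then have "bij \<rho>" by (intro o_bij[of \<rho>]) (auto simp: fun_eq_iff)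
  moreover have "\<rho> ` W \<inter> V = {}" using n by (auto simp: \<rho>_def)
  ultimately show ?thesis using that inv by blast
qed

text \<open>\<open>\<tau>\<close> is the renaming of the clause followed by the mgu \<open>\<theta>\<close>.\<close>

lemma clause_resolventE:
  assumes "clause_resolvent \<Sigma> P Q Q'"
  obtains A Ls C \<theta> \<tau> where "Q = Pos A # Ls" "C \<in> P" "wf_subst \<Sigma> \<theta>" "wf_subst \<Sigma> \<tau>"
    "subst_atom \<theta> A = subst_atom \<tau> (head C)"
    "Q' = subst_query \<tau> (body C) @ subst_query \<theta> Ls"
  using assms
proof cases
  case (1 C C' A Ls \<theta>)
  then obtain \<rho> where C': "C' = subst_clause (\<lambda>x. Var (\<rho> x)) C" by (auto simp: variant_def)
  have \<theta>: "wf_subst \<Sigma> \<theta>" "subst_atom \<theta> A = subst_atom \<theta> (head C')"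
    using 1 by (auto simp: is_mgu_def)
  have \<tau>: "wf_subst \<Sigma> (subst_comp \<theta> (\<lambda>x. Var (\<rho> x)))"
    by (rule wf_subst_comp[OF \<theta>(1)]) (simp add: wf_subst_def)
  show ?thesis
    by (rule that[of A Ls C \<theta> "subst_comp \<theta> (\<lambda>x. Var (\<rho> x))"])
      (use \<tau> 1 C' \<theta> in auto)
qed

lemma clause_resolvent_wf:
  assumes "wf_program \<Sigma> P" "clause_resolvent \<Sigma> P Q Q'" "wf_query \<Sigma> Q"
  shows "wf_query \<Sigma> Q'"
  using assms(2)
  by (rule clause_resolventE)
    (use assms in \<open>auto simp: wf_program_def wf_clause_def wf_query_subst\<close>)

section \<open>Relations occurring in resolvents\<close>

lemma clause_resolvent_literals:
  assumes "clause_resolvent \<Sigma> P Q Q'" "L' \<in> set Q'"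
  obtains (query) L \<sigma> where "L \<in> set Q" "L' = subst_literal \<sigma> L"
  | (clause) A Ls C L \<sigma> where "Q = Pos A # Ls" "C \<in> P" "pred A = pred (head C)" "L \<in> set (body C)"
      "L' = subst_literal \<sigma> L"
  using assms(1)
proof (rule clause_resolventE)
  fix A Ls C \<theta> \<tau>
  assume *: "Q = Pos A # Ls" "C \<in> P" "subst_atom \<theta> A = subst_atom \<tau> (head C)"
    "Q' = subst_query \<tau> (body C) @ subst_query \<theta> Ls"
  from *(3) have "pred A = pred (head C)" by (metis pred_subst_atom)
  with * assms(2) show thesis
    by (auto simp: subst_query_def intro: query clause)
qed

lemma subst_literal_eq_Neg: "subst_literal \<sigma> L = Neg A \<Longrightarrow> \<exists>B. L = Neg B \<and> pred B = pred A"
  by (cases L) auto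

text \<open>The set \<open>N\<close> is left open: soundness takes \<open>neg_rels_star P\<close>,
  the termination proof takes the negated relations themselves.\<close>

lemma clause_resolvent_neg_preds:
  assumes "clause_resolvent \<Sigma> P Q Q'" "neg_rels P \<subseteq> N"
    and "\<forall>A. Neg A \<in> set Q \<longrightarrow> pred A \<in> N"
  shows "\<forall>A. Neg A \<in> set Q' \<longrightarrow> pred A \<in> N"
proof (intro allI impI)
  fix A assume "Neg A \<in> set Q'"
  from assms(1) this show "pred A \<in> N"
  proof (cases rule: clause_resolvent_literals)
    case (query L \<sigma>)
    then show ?thesis using assms(3) subst_literal_eq_Neg[of \<sigma> L A] by auto
  next
    case (clause A' Ls C L \<sigma>)
    then show ?thesis using assms(2) subst_literal_eq_Neg[of \<sigma> L A]
      by (force simp: neg_rels_def)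
  qed
qed

text \<open>Applied to \<open>neg_rels_star P\<close> and, for the program \<open>R\<close>, to the
  complement of the relations defined in \<open>P\<close>.\<close>

lemma clause_resolvent_preds:
  assumes "clause_resolvent \<Sigma> P Q Q'" "refers_to P `` N \<subseteq> N"
    and "\<forall>L \<in> set Q. pred (atom_of L) \<in> N"
  shows "\<forall>L \<in> set Q'. pred (atom_of L) \<in> N"
proof
  fix L' assume "L' \<in> set Q'"
  from assms(1) this show "pred (atom_of L') \<in> N"
  proof (cases rule: clause_resolvent_literals)
    case (query L \<sigma>)
    then show ?thesis using assms(3) by auto
  next
    case (clause A Ls C L \<sigma>)
    then have "(pred A, pred (atom_of L)) \<in> refers_to P" by (auto simp: refers_to_def)
    then show ?thesis using clause assms(2,3) by auto
  qed
qed

lemma neg_rels_subset_star: "neg_rels P \<subseteq> neg_rels_star P"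
  by (auto simp: neg_rels_star_def)

lemma neg_rels_star_closed: "refers_to P `` neg_rels_star P \<subseteq> neg_rels_star P"
  by (auto simp: neg_rels_star_def intro: rtrancl_into_rtrancl)

section \<open>Resolution steps and satisfiability in a model\<close>

lemma clause_resolvent_sat:
  assumes "is_model M P" "clause_resolvent \<Sigma> P Q Q'" "sat_query M v Q'"
  shows "\<exists>u. sat_query M u Q"
  using assms(2)
proof (rule clause_resolventE)
  fix A Ls C \<theta> \<tau>
  assume *: "Q = Pos A # Ls" "C \<in> P" "subst_atom \<theta> A = subst_atom \<tau> (head C)"
    "Q' = subst_query \<tau> (body C) @ subst_query \<theta> Ls"
  then have "sat_atom M v (subst_atom \<tau> (head C))"
    using assms(1,3) by (auto simp: is_model_def)
  then have "sat_atom M v (subst_atom \<theta> A)" by (simp only: *(3))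
  then have "sat_query M v (subst_query \<theta> Q)" using *(1,4) assms(3) by simp
  then show ?thesis by auto
qed

text \<open>Lifting from values to terms: \<open>v\<close> and \<open>u\<close> are merged into one
  valuation under which the selected atom and the renamed head have equal argument values. The mgu
  then exists, and the valuation left after factoring through it satisfies the resolvent.\<close>

lemma clause_resolvent_exists:
  assumes "free_equality \<Sigma> M" "wf_atom \<Sigma> A" "wf_clause \<Sigma> C" "C \<in> P" "pred (head C) = pred A"
    and ds: "map (eval_trm M v) (args A) = map (eval_trm M u) (args (head C))"
    and "sat_query M u (body C)" "sat_query M v Ls"
  shows "\<exists>Q' w. clause_resolvent \<Sigma> P (Pos A # Ls) Q' \<and> sat_query M w Q'"
proof -
  let ?V = "vars_query (Pos A # Ls)"
  obtain \<rho> where \<rho>: "bij \<rho>" "\<And>x. \<rho> (\<rho> x) = x" "\<rho> ` vars_clause C \<inter> ?V = {}"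
    using renaming_apart[of ?V "vars_clause C"] by auto
  let ?r = "\<lambda>x. Var (\<rho> x)"
  define C' where "C' = subst_clause ?r C"
  \<comment> \<open>Variables of the renamed clause lie outside \<open>?V\<close> and get the value
    of their originals under \<open>u\<close>; here \<rho> acts as its own inverse.\<close>
  define z where "z x = (if x \<in> ?V then v x else u (\<rho> x))" for x
  have z_C: "z (\<rho> x) = u x" if "x \<in> vars_clause C" for x
    using \<rho> that by (auto simp: z_def)
  have "map (eval_trm M z) (args A) = map (eval_trm M v) (args A)"
    by (rule map_eval_cong) (auto simp: z_def vars_query_def)
  also have "\<dots> = map (eval_trm M (\<lambda>x. z (\<rho> x))) (args (head C))"
    unfolding ds by (rule map_eval_cong) (auto simp: z_C vars_clause_def)
  finally have "map (eval_trm M z) (args A) = map (eval_trm M z) (args (head C'))"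
    by (simp add: C'_def subst_atom_def)
  moreover have "wf_atom \<Sigma> (head C')"
    using assms(3) by (auto simp: C'_def wf_clause_def wf_subst_def intro!: wf_atom_subst)
  ultimately obtain \<theta> w where mgu: "is_mgu \<Sigma> \<theta> A (head C')"
    and z: "z = (\<lambda>x. eval_trm M w (\<theta> x))"
    using free_equality_atom_mgu[of \<Sigma> M A "head C'" z] assms by (auto simp: C'_def)
  have "sat_query M (\<lambda>x. z (\<rho> x)) (body C)"
    using assms(7) sat_query_cong[of "body C" "\<lambda>x. z (\<rho> x)" u M] z_C
    by (auto simp: vars_clause_def)
  then have "sat_query M z (body C')" by (simp add: C'_def)
  moreover have "sat_query M z Ls"
    using assms(8) sat_query_cong[of Ls z v M] by (auto simp: z_def vars_query_def)
  ultimately have "sat_query M w (subst_query \<theta> (body C' @ Ls))" by (simp add: z)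
  moreover have "clause_resolvent \<Sigma> P (Pos A # Ls) (subst_query \<theta> (body C' @ Ls))"
  proof (rule clause_resolvent.intros[OF assms(4) _ _ mgu])
    show "variant C' C" using \<rho>(1) by (auto simp: variant_def C'_def)
    show "vars_clause C' \<inter> ?V = {}" using \<rho>(3) by (auto simp: C'_def vars_subst_clause)
  qed
  ultimately show ?thesis by blast
qed

text \<open>The only-if direction of the completed definition supplies the clause and the values of
  its variables.\<close>

lemma complete_model_clause_resolvent:
  assumes "complete_model \<Sigma> M P" "wf_program \<Sigma> P" "wf_atom \<Sigma> A" "pred A \<in> neg_rels_star P"
    and "sat_query M v (Pos A # Ls)"
  shows "\<exists>Q' w. clause_resolvent \<Sigma> P (Pos A # Ls) Q' \<and> sat_query M w Q'"
proof -
  have mc: "models_completion \<Sigma> (neg_rels_star P) M (neg_part P)"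
    using assms(1) by (simp add: complete_model_def)
  have "pred_int M (pred A) (map (eval_trm M v) (args A))"
    using assms(5) by (simp add: sat_atom_def)
  then obtain C u where "C \<in> neg_part P" "pred (head C) = pred A"
    "map (eval_trm M v) (args A) = map (eval_trm M u) (args (head C))" "sat_query M u (body C)"
    using mc assms(3,4) unfolding models_completion_def by (metis length_map wf_atom_def)
  then show ?thesis
    using clause_resolvent_exists[of \<Sigma> M A C P v u Ls] mc assms
    by (auto simp: models_completion_def wf_program_def neg_part_def)
qed

text \<open>Both halves are proved together, since negation exchanges them: a negative literal fails
  through success of its subsidiary tree and is removed through failure of it. Success uses that
  \<open>M\<close> is a model; failure uses the completion, hence the restriction to
  \<open>neg_rels_star P\<close>. The inclusion \<open>S \<subseteq> {Failure}\<close> passes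
  directly from the union at a node to each child.\<close>

lemma ldnf_tree_sound:
  assumes M: "complete_model \<Sigma> M P" and P: "wf_program \<Sigma> P"
  shows "ldnf_tree \<Sigma> P Q S \<Longrightarrow> wf_query \<Sigma> Q \<Longrightarrow> \<forall>A. Neg A \<in> set Q \<longrightarrow> pred A \<in> neg_rels_star P \<Longrightarrow>
    (Success \<in> S \<longrightarrow> (\<exists>v. sat_query M v Q)) \<and>
    (S \<subseteq> {Failure} \<and> (\<forall>L \<in> set Q. pred (atom_of L) \<in> neg_rels_star P) \<longrightarrow> \<not> (\<exists>v. sat_query M v Q))"
proof (induction rule: ldnf_tree.induct)
  case empty
  then show ?case by simp
next
  case (pos_fail A Ls)
  then show ?case using complete_model_clause_resolvent[OF M P, of A] by fastforce
next
  case (pos_step A Ls F)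
  have Q': "wf_query \<Sigma> Q'" "\<forall>A. Neg A \<in> set Q' \<longrightarrow> pred A \<in> neg_rels_star P"
    if "clause_resolvent \<Sigma> P (Pos A # Ls) Q'" for Q'
    using clause_resolvent_wf[OF P that] pos_step.prems
      clause_resolvent_neg_preds[OF that neg_rels_subset_star] by auto
  note IH = pos_step.IH[OF _ Q']
  have "\<exists>v. sat_query M v (Pos A # Ls)"
    if "Success \<in> F Q'" "clause_resolvent \<Sigma> P (Pos A # Ls) Q'" for Q'
    using IH[OF that(2) that(2) that(2)] that M clause_resolvent_sat[OF _ that(2)]
    by (auto simp: complete_model_def)
  moreover have "\<not> sat_query M v (Pos A # Ls)"
    if fail: "(\<Union>Q \<in> {Q. clause_resolvent \<Sigma> P (Pos A # Ls) Q}. F Q) \<subseteq> {Failure}"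
      and preds: "\<forall>L \<in> set (Pos A # Ls). pred (atom_of L) \<in> neg_rels_star P" for v
  proof
    assume "sat_query M v (Pos A # Ls)"
    then obtain Q' w where res: "clause_resolvent \<Sigma> P (Pos A # Ls) Q'" and "sat_query M w Q'"
      using complete_model_clause_resolvent[OF M P, of A v Ls] pos_step.prems preds by auto
    moreover have "F Q' \<subseteq> {Failure}" using fail res by auto
    moreover have "\<forall>L \<in> set Q'. pred (atom_of L) \<in> neg_rels_star P"
      using clause_resolvent_preds[OF res neg_rels_star_closed preds] .
    ultimately show False using IH[OF res res res] by auto
  qed
  ultimately show ?case by blast
next
  case (neg_nonground A Ls)
  then show ?case by simp
next
  case (neg_step A Ls S)
  then show ?case by auto
next
  case (neg_fail A S Ls)
  then obtain v where "sat_atom M v A" by auto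
  \<comment> \<open>\<open>A\<close> is ground, so its truth under one valuation is its truth under
    all.\<close>
  then have "sat_atom M u A" for u using neg_fail.hyps(1) sat_atom_cong[of A u v M] by auto
  then show ?case by auto
next
  case (neg_flounder A S Ls)
  then show ?case by simp
qed


section \<open>Well-typed queries\<close>

text \<open>The common form of well-typedness and acceptability.\<close>

fun chain :: "('a \<Rightarrow> bool) \<Rightarrow> ('a \<Rightarrow> bool) \<Rightarrow> 'a list \<Rightarrow> bool" where
  "chain p g [] \<longleftrightarrow> True"
| "chain p g (x # xs) \<longleftrightarrow> g x \<and> (p x \<longrightarrow> chain p g xs)"

text \<open>Fits the shape of a resolvent: the clause body comes first, and the rest of the query
  counts only if all of the body satisfies \<open>p\<close>.\<close>

lemma chain_append [simp]:
  "chain p g (xs @ ys) \<longleftrightarrow> chain p g xs \<and> ((\<forall>x \<in> set xs. p x) \<longrightarrow> chain p g ys)"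
  by (induction xs) auto

lemma chain_iff_nth:
  "chain p g xs \<longleftrightarrow> (\<forall>j < length xs. (\<forall>x \<in> set (take j xs). p x) \<longrightarrow> g (xs ! j))"
  by (induction xs) (auto simp: All_less_Suc2)

lemma chainI:
  "(\<And>As B Bs. xs = As @ B # Bs \<Longrightarrow> \<forall>A \<in> set As. p A \<Longrightarrow> g B) \<Longrightarrow> chain p g xs"
  unfolding chain_iff_nth by (metis id_take_nth_drop)

lemma chain_all: "(\<And>x. x \<in> set xs \<Longrightarrow> g x) \<Longrightarrow> chain p g xs"
  by (induction xs) auto

definition args_ok ::
  "('p \<Rightarrow> nat \<Rightarrow> mode) \<Rightarrow> ('p \<Rightarrow> nat \<Rightarrow> 'f trm set) \<Rightarrow> mode \<Rightarrow> ('f, 'p) atom \<Rightarrow> bool" where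
  "args_ok m ty d A \<longleftrightarrow> (\<forall>i < length (args A). m (pred A) i = d \<longrightarrow> args A ! i \<in> ty (pred A) i)"

fun out_ok ::
  "('p \<Rightarrow> nat \<Rightarrow> mode) \<Rightarrow> ('p \<Rightarrow> nat \<Rightarrow> 'f trm set) \<Rightarrow> ('f, 'p) literal \<Rightarrow> bool" where
  "out_ok m ty (Pos A) \<longleftrightarrow> args_ok m ty Out A"
| "out_ok m ty (Neg A) \<longleftrightarrow> True"

abbreviation in_ok ::
  "('p \<Rightarrow> nat \<Rightarrow> mode) \<Rightarrow> ('p \<Rightarrow> nat \<Rightarrow> 'f trm set) \<Rightarrow> ('f, 'p) literal \<Rightarrow> bool" where
  "in_ok m ty L \<equiv> args_ok m ty In (atom_of L)"

lemma typed_args_ok: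
  "(\<forall>(s, T) \<in> set (typed_args d m ty A). subst_trm \<theta> s \<in> T) \<longleftrightarrow> args_ok m ty d (subst_atom \<theta> A)"
  by (auto simp: typed_args_def args_ok_def subst_atom_def)

text \<open>Turns the premises of a judgement into a condition on the literals of the instance, so
  that typing becomes a \<open>chain\<close> condition on each instance.\<close>

lemma positive_outputs_ok:
  "(\<forall>(s, T) \<in> set (positive_outputs m ty Q). subst_trm \<theta> s \<in> T) \<longleftrightarrow>
   (\<forall>L \<in> set (subst_query \<theta> Q). out_ok m ty L)"
proof (induction Q)
  case (Cons L Q)
  then show ?case using typed_args_ok[of Out m ty "atom_of L" \<theta>]
    by (cases L) (simp_all add: ball_Un)
qed simp

lemma subst_query_nth: "j < length Q \<Longrightarrow> subst_query \<theta> Q ! j = subst_literal \<theta> (Q ! j)"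
  by (simp add: subst_query_def)

lemma subst_query_take: "subst_query \<theta> (take j Q) = take j (subst_query \<theta> Q)"
  by (simp add: subst_query_def take_map)

lemma well_typed_query_iff:
  "well_typed_query \<Sigma> m ty Q \<longleftrightarrow>
   (\<forall>\<theta>. wf_subst \<Sigma> \<theta> \<longrightarrow> chain (out_ok m ty) (in_ok m ty) (subst_query \<theta> Q))"
  unfolding well_typed_query_def judgement_def typed_args_ok positive_outputs_ok chain_iff_nth
  by (auto simp: subst_query_nth subst_query_take)

lemma well_typed_clause_iff:
  "well_typed_clause \<Sigma> m ty C \<longleftrightarrow>
   (\<forall>\<theta>. wf_subst \<Sigma> \<theta> \<longrightarrow> args_ok m ty In (subst_atom \<theta> (head C)) \<longrightarrow>
      chain (out_ok m ty) (in_ok m ty) (subst_query \<theta> (body C)) \<and>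
      ((\<forall>L \<in> set (subst_query \<theta> (body C)). out_ok m ty L) \<longrightarrow>
         args_ok m ty Out (subst_atom \<theta> (head C))))"
  unfolding well_typed_clause_def judgement_def chain_iff_nth set_append ball_Un typed_args_ok
    positive_outputs_ok
  by (auto simp: subst_query_nth subst_query_take)

text \<open>In each instance the inputs of the selected atom are those of the clause head, which
  types the body. If all outputs of the body are correct, so are those of the head, hence of the
  selected atom, and the typing of \<open>Ls\<close> resumes.\<close>

lemma clause_resolvent_well_typed:
  assumes "well_typed_program \<Sigma> m ty P" "clause_resolvent \<Sigma> P Q Q'" "well_typed_query \<Sigma> m ty Q"
  shows "well_typed_query \<Sigma> m ty Q'"
  using assms(2)
proof (rule clause_resolventE)
  fix A Ls C \<theta> \<tau>
  assume Q: "Q = Pos A # Ls" and C: "C \<in> P" and wf: "wf_subst \<Sigma> \<theta>" "wf_subst \<Sigma> \<tau>"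
    and eq: "subst_atom \<theta> A = subst_atom \<tau> (head C)"
    and Q': "Q' = subst_query \<tau> (body C) @ subst_query \<theta> Ls"
  show ?thesis unfolding well_typed_query_iff
  proof (intro allI impI)
    fix \<sigma> assume \<sigma>: "wf_subst \<Sigma> \<sigma>"
    let ?\<theta> = "subst_comp \<sigma> \<theta>" and ?\<tau> = "subst_comp \<sigma> \<tau>"
    have wf': "wf_subst \<Sigma> ?\<theta>" "wf_subst \<Sigma> ?\<tau>" using \<sigma> wf by (auto intro: wf_subst_comp)
    have "subst_atom ?\<theta> A = subst_atom ?\<tau> (head C)"
      using eq by (metis subst_atom_subst_atom)
    moreover have "chain (out_ok m ty) (in_ok m ty) (subst_query ?\<theta> Q)"
      using assms(3) wf' by (simp add: well_typed_query_iff)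
    moreover have "well_typed_clause \<Sigma> m ty C" using assms(1) C by (simp add: well_typed_program_def)
    ultimately show "chain (out_ok m ty) (in_ok m ty) (subst_query \<sigma> Q')"
      using wf' unfolding well_typed_clause_iff Q Q' by auto
  qed
qed

lemma well_typed_query_hd: "well_typed_query \<Sigma> m ty (L # Ls) \<Longrightarrow> well_typed_query \<Sigma> m ty [L]"
  by (simp add: well_typed_query_iff)

lemma well_typed_query_Neg:
  "well_typed_query \<Sigma> m ty (Neg A # Ls) \<Longrightarrow> well_typed_query \<Sigma> m ty Ls"
  "well_typed_query \<Sigma> m ty [Neg A] \<Longrightarrow> well_typed_query \<Sigma> m ty [Pos A]"
  by (simp_all add: well_typed_query_iff)


section \<open>Termination of LDNF-derivations\<close>

text \<open>The accessible part of the converse step relation, which gives induction along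
  derivations.\<close>

abbreviation terminating ::
  "('f, 'p) signature \<Rightarrow> ('f, 'p) program \<Rightarrow> ('f, 'p) query \<Rightarrow> bool" where
  "terminating \<Sigma> P \<equiv> Wellfounded.accp (\<lambda>Q' Q. ldnf_step \<Sigma> P Q Q')"

lemma all_derivations_finite_iff_terminating:
  "all_derivations_finite \<Sigma> P Q \<longleftrightarrow> terminating \<Sigma> P Q"
proof
  assume fin: "all_derivations_finite \<Sigma> P Q"
  show "terminating \<Sigma> P Q"
  proof (rule ccontr)
    assume "\<not> terminating \<Sigma> P Q"
    moreover have "\<exists>Q''. \<not> terminating \<Sigma> P Q'' \<and> ldnf_step \<Sigma> P Q' Q''"
      if "\<not> terminating \<Sigma> P Q'" for Q'
      using not_accp_down[OF that] by blast
    ultimately have "\<exists>S. \<forall>n. (\<not> terminating \<Sigma> P (S n) \<and> (n = 0 \<longrightarrow> S n = Q)) \<and>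
        ldnf_step \<Sigma> P (S n) (S (Suc n))"
      by (intro dependent_nat_choice) auto
    then show False using fin unfolding all_derivations_finite_def by blast
  qed
next
  assume "terminating \<Sigma> P Q"
  then show "all_derivations_finite \<Sigma> P Q"
  proof (induction rule: accp_induct_rule)
    case (1 Q)
    have False if "S 0 = Q" "\<forall>k. ldnf_step \<Sigma> P (S k) (S (Suc k))" for S
    proof -
      have "all_derivations_finite \<Sigma> P (S (Suc 0))" using 1 that by metis
      then show False
        using that(2) by (auto simp: all_derivations_finite_def dest: spec[of _ "\<lambda>k. S (Suc k)"])
    qed
    then show ?case unfolding all_derivations_finite_def by blast
  qed
qed

lemma terminating_Nil: "terminating \<Sigma> P []"
  by (rule accpI) (auto elim!: ldnf_step.cases resolvent.cases clause_resolvent.cases)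

lemma terminatingI:
  assumes "\<And>Q'. clause_resolvent \<Sigma> P [Pos A] Q' \<Longrightarrow> terminating \<Sigma> P Q'"
  shows "terminating \<Sigma> P [Pos A]"
  by (rule accpI) (use assms in \<open>auto elim!: ldnf_step.cases resolvent.cases\<close>)

text \<open>A step from \<open>[Neg A]\<close> leads either to the empty query or to the subsidiary
  root \<open>[Pos A]\<close>.\<close>

lemma terminating_NegI:
  assumes "terminating \<Sigma> P [Pos A]"
  shows "terminating \<Sigma> P [Neg A]"
  by (rule accpI)
    (use assms terminating_Nil in \<open>auto elim!: ldnf_step.cases resolvent.cases clause_resolvent.cases\<close>)

text \<open>A derivation of \<open>L # Ls\<close> runs as a derivation of \<open>[L]\<close> with instances of \<open>Ls\<close> appended,
  until \<open>L\<close> has been resolved away and an instance of \<open>Ls\<close> is left.\<close>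

lemma terminating_if_heads_terminating:
  assumes closed: "\<And>Q Q'. I Q \<Longrightarrow> resolvent \<Sigma> P Q Q' \<Longrightarrow> I Q'"
    and hd: "\<And>L Ls. I (L # Ls) \<Longrightarrow> terminating \<Sigma> P [L]"
  shows "I Q \<Longrightarrow> terminating \<Sigma> P Q"
proof (induction "length Q" arbitrary: Q)
  case 0
  then show ?case by (simp add: terminating_Nil)
next
  case (Suc n)
  \<comment> \<open>An inner induction on the termination of \<open>B\<close>, inside the one on the
    length of the query. \<open>Ls\<close> stays arbitrary because each step instantiates it; only
    its length is preserved. When \<open>B\<close> is used up, the outer hypothesis applies.\<close>
  have append: "I (B @ Ls) \<Longrightarrow> length Ls = n \<Longrightarrow> terminating \<Sigma> P (B @ Ls)"
    if "terminating \<Sigma> P B" for B Ls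
    using that
  proof (induction B arbitrary: Ls rule: accp_induct_rule)
    case (1 B)
    show ?case
    proof (cases B)
      case Nil
      then show ?thesis using "1.prems" Suc.hyps(1) by simp
    next
      case B: (Cons L B')
      show ?thesis
      proof (rule accpI)
        fix Q' assume "ldnf_step \<Sigma> P (B @ Ls) Q'"
        then show "terminating \<Sigma> P Q'"
        proof cases
          case res: 1
          have Q': "I Q'" using closed[OF "1.prems"(1) res] .
          from res show ?thesis
          proof cases
            case 1
            then show ?thesis
            proof cases
              case (1 C C' A Ls' \<theta>)
              then have L: "L = Pos A" "Ls' = B' @ Ls" using B by auto
              \<comment> \<open>A variant renamed apart from the whole query is also renamed apart
                from its prefix \<open>B\<close>.\<close>
              have "clause_resolvent \<Sigma> P (Pos A # B') (subst_query \<theta> (body C' @ B'))"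
                by (rule clause_resolvent.intros) (use 1 L in \<open>auto simp: vars_query_def\<close>)
              then have step: "ldnf_step \<Sigma> P B (subst_query \<theta> (body C' @ B'))"
                using B L by (auto intro: ldnf_step.intros resolvent.intros)
              have "Q' = subst_query \<theta> (body C' @ B') @ subst_query \<theta> Ls"
                using 1 L by simp
              then show ?thesis using "1.IH"[OF step] Q' "1.prems" by simp
            qed
          next
            case (2 A)
            then have "ldnf_step \<Sigma> P B B'" "Q' = B' @ Ls"
              using B by (auto intro: ldnf_step.intros resolvent.intros)
            then show ?thesis using "1.IH" Q' "1.prems" by blast
          qed
        next
          case (2 A Ls')
          then have "ldnf_step \<Sigma> P B Q'" using B by (auto intro: ldnf_step.intros)
          then show ?thesis by (rule accp_downward[OF "1.hyps"])
        qed
      qed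
    qed
  qed
  obtain L Ls where Q: "Q = L # Ls" using Suc.hyps(2) by (cases Q) auto
  have "I (L # Ls)" "length Ls = n" using Suc.prems Suc.hyps(2) Q by auto
  with append[OF hd[OF this(1)]] show ?case unfolding Q by simp
qed


section \<open>Queries over the extended program\<close>

text \<open>The clause used has the relation of the selected atom in its head, so it belongs to
  \<open>R\<close>, whose clauses mention no relation defined in \<open>P\<close>.\<close>

lemma clause_resolvent_extends:
  assumes "extends P R" "\<forall>L \<in> set Q. pred (atom_of L) \<notin> defined_rels P"
    and "clause_resolvent \<Sigma> (P \<union> R) Q Q'"
  shows "clause_resolvent \<Sigma> R Q Q'" "\<forall>L \<in> set Q'. pred (atom_of L) \<notin> defined_rels P"
proof -
  show res: "clause_resolvent \<Sigma> R Q Q'"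
    using assms(3)
  proof cases
    case (1 C C' A Ls \<theta>)
    have "subst_atom \<theta> A = subst_atom \<theta> (head C')" using 1(6) by (simp add: is_mgu_def)
    then have "pred A = pred (head C)"
      using 1(4) by (metis head_body_subst_clause(1) pred_subst_atom variant_def)
    then have "C \<notin> P" using assms(2) 1 by (auto simp: defined_rels_def)
    then have "C \<in> R" using 1(3) by blast
    then show ?thesis unfolding 1(1,2) using 1(4-6) by (rule clause_resolvent.intros)
  qed
  have "refers_to R `` (- defined_rels P) \<subseteq> - defined_rels P"
    using assms(1) by (auto simp: refers_to_def extends_def occurring_rels_def)
  from clause_resolvent_preds[OF res this] assms(2)
  show "\<forall>L \<in> set Q'. pred (atom_of L) \<notin> defined_rels P" by auto
qed

lemma clause_resolvent_mono:
  "clause_resolvent \<Sigma> R Q Q' \<Longrightarrow> R \<subseteq> P \<Longrightarrow> clause_resolvent \<Sigma> P Q Q'"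
  by (induction rule: clause_resolvent.induct) (blast intro: clause_resolvent.intros)

text \<open>On such queries both programs have the same resolvents, so the trees coincide. Needed
  because a step at a negative literal depends on the finite failure of a subsidiary tree.\<close>

lemma ldnf_tree_extends:
  assumes ext: "extends P R"
  shows "ldnf_tree \<Sigma> (P \<union> R) Q S \<Longrightarrow> \<forall>L \<in> set Q. pred (atom_of L) \<notin> defined_rels P \<Longrightarrow>
    ldnf_tree \<Sigma> R Q S"
proof (induction rule: ldnf_tree.induct)
  case (pos_fail A Ls)
  then show ?case by (metis clause_resolvent_mono ldnf_tree.pos_fail sup_ge2)
next
  case (pos_step A Ls F)
  have iff: "clause_resolvent \<Sigma> (P \<union> R) (Pos A # Ls) Q' \<longleftrightarrow> clause_resolvent \<Sigma> R (Pos A # Ls) Q'"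
    for Q'
    using clause_resolvent_extends(1)[OF ext pos_step.prems] clause_resolvent_mono[of \<Sigma> R _ _ "P \<union> R"]
    by blast
  have "ldnf_tree \<Sigma> R Q' (F Q')" if "clause_resolvent \<Sigma> (P \<union> R) (Pos A # Ls) Q'" for Q'
    using pos_step.IH[OF that] clause_resolvent_extends(2)[OF ext pos_step.prems that] by blast
  then show ?case
    using ldnf_tree.pos_step[of \<Sigma> R A Ls F] pos_step.hyps(1) unfolding iff by blast
qed (auto intro: ldnf_tree.intros)

lemma ldnf_step_extends:
  assumes "extends P R" "\<forall>L \<in> set Q. pred (atom_of L) \<notin> defined_rels P"
    and "ldnf_step \<Sigma> (P \<union> R) Q Q'"
  shows "ldnf_step \<Sigma> R Q Q' \<and> (\<forall>L \<in> set Q'. pred (atom_of L) \<notin> defined_rels P)"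
  using assms(3)
proof cases
  case 1
  then show ?thesis
  proof cases
    case 1
    then show ?thesis using clause_resolvent_extends[OF assms(1,2)]
      by (blast intro: ldnf_step.intros resolvent.intros)
  next
    case (2 A)
    then have "finitely_failed \<Sigma> R [Pos A]"
      using ldnf_tree_extends[OF assms(1), of \<Sigma> "[Pos A]"] assms(2)
      by (simp add: finitely_failed_def)
    then show ?thesis using 2 assms(2) by (auto intro: ldnf_step.intros resolvent.intros)
  qed
next
  case (2 A Ls)
  then show ?thesis using assms(2) by (auto intro: ldnf_step.intros)
qed

text \<open>Carries the termination assumption on \<open>R\<close> over to the whole
  program.\<close>

lemma terminating_extends:
  assumes "extends P R"
  shows "terminating \<Sigma> R Q \<Longrightarrow> \<forall>L \<in> set Q. pred (atom_of L) \<notin> defined_rels P \<Longrightarrow>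
    terminating \<Sigma> (P \<union> R) Q"
proof (induction rule: accp_induct_rule)
  case (1 Q)
  then show ?case using ldnf_step_extends[OF assms "1.prems"] by (blast intro: accpI)
qed


section \<open>Bounded queries\<close>

text \<open>Ground on all variables, so that composition with an arbitrary mgu or renaming is ground
  again.\<close>

definition ground_subst :: "('f, 'p) signature \<Rightarrow> 'f subst \<Rightarrow> bool" where
  "ground_subst \<Sigma> \<sigma> \<longleftrightarrow> wf_subst \<Sigma> \<sigma> \<and> (\<forall>x. vars_trm (\<sigma> x) = {})"

lemma ground_subst_comp:
  "ground_subst \<Sigma> \<sigma> \<Longrightarrow> wf_subst \<Sigma> \<theta> \<Longrightarrow> ground_subst \<Sigma> (subst_comp \<sigma> \<theta>)"
  by (auto simp: ground_subst_def intro: wf_subst_comp) (auto simp: subst_comp_def vars_subst_trm)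

lemma ex_ground_subst: "has_constant \<Sigma> \<Longrightarrow> \<exists>\<sigma>. ground_subst \<Sigma> \<sigma>"
proof -
  assume "has_constant \<Sigma>"
  then obtain c where "fun_arity \<Sigma> c = 0" by (auto simp: has_constant_def)
  then have "ground_subst \<Sigma> (\<lambda>_. Fun c [])" by (simp add: ground_subst_def wf_subst_def)
  then show ?thesis by blast
qed

abbreviation valid :: "('f, 'p, 'd) interp \<Rightarrow> ('f, 'p) literal \<Rightarrow> bool" where
  "valid M L \<equiv> \<forall>v. sat_literal M v L"

text \<open>Literals not defined in \<open>P\<close> are unconstrained: their termination comes from
  \<open>R\<close>, whatever their level.\<close>

definition level_below ::
  "('f, 'p) program \<Rightarrow> ('f, 'p) level_mapping \<Rightarrow> nat \<Rightarrow> ('f, 'p) literal \<Rightarrow> bool" where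
  "level_below P lev k L \<longleftrightarrow> (pred (atom_of L) \<in> defined_rels P \<longrightarrow> lev (atom_of L) < k)"

definition bounded_query ::
  "('f, 'p) signature \<Rightarrow> ('f, 'p) program \<Rightarrow> ('f, 'p) level_mapping \<Rightarrow> ('f, 'p, 'd) interp \<Rightarrow> nat
   \<Rightarrow> ('f, 'p) query \<Rightarrow> bool" where
  "bounded_query \<Sigma> P lev M k Q \<longleftrightarrow>
     (\<forall>\<sigma>. ground_subst \<Sigma> \<sigma> \<longrightarrow> chain (valid M) (level_below P lev k) (subst_query \<sigma> Q))"

lemma acceptable_chain:
  assumes "acceptable \<Sigma> P lev M" "C \<in> P" "ground_subst \<Sigma> \<sigma>"
  shows "chain (valid M) (\<lambda>L. lev (atom_of L) < lev (subst_atom \<sigma> (head C))) (subst_query \<sigma> (body C))"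
proof (rule chainI)
  fix As B Bs
  assume split: "subst_query \<sigma> (body C) = As @ B # Bs" and "\<forall>A \<in> set As. valid M A"
  then have "models_query M As" by (simp add: models_query_def sat_query_def)
  moreover have "vars_clause (subst_clause \<sigma> C) = {}"
    using assms(3) by (auto simp: vars_subst_clause ground_subst_def)
  then have "subst_clause \<sigma> C \<in> ground_program \<Sigma> P"
    using assms(2,3) unfolding ground_program_def ground_subst_def by blast
  then have "Clause (subst_atom \<sigma> (head C)) (As @ B # Bs) \<in> ground_program \<Sigma> P"
    by (simp add: subst_clause_def split)
  ultimately show "lev (atom_of B) < lev (subst_atom \<sigma> (head C))"
    using assms(1) by (auto simp: acceptable_def)
qed

lemma chain_mono: "chain p g xs \<Longrightarrow> (\<And>x. x \<in> set xs \<Longrightarrow> g x \<Longrightarrow> h x) \<Longrightarrow> chain p h xs"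
  by (induction xs) auto

text \<open>For a clause of \<open>P\<close> the head has level at most \<open>k\<close>, and
  acceptability puts the body strictly below it. For a clause of \<open>R\<close> no body relation
  is defined in \<open>P\<close>.\<close>

lemma body_level_below:
  assumes "acceptable \<Sigma> P lev M" "extends P R" "C \<in> P \<union> R" "ground_subst \<Sigma> \<sigma>"
    and "level_below P lev (Suc k) (Pos (subst_atom \<sigma> (head C)))"
  shows "chain (valid M) (level_below P lev k) (subst_query \<sigma> (body C))"
proof (cases "C \<in> P")
  case True
  then have "lev (subst_atom \<sigma> (head C)) \<le> k"
    using assms(5) by (auto simp: level_below_def defined_rels_def)
  then show ?thesis
    using chain_mono[OF acceptable_chain[OF assms(1) True assms(4)]] by (force simp: level_below_def)
next
  case False
  then have "C \<in> R" using assms(3) by simp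
  then show ?thesis
    using assms(2)
    by (intro chain_all)
      (fastforce simp: level_below_def extends_def occurring_rels_def subst_query_def)
qed

lemma level_below_Suc: "level_below P lev k L \<Longrightarrow> level_below P lev (Suc k) L"
  by (auto simp: level_below_def)

text \<open>The same pattern as for well-typedness, with validity in \<open>M\<close> in place of
  correct outputs: if the body instance is valid, so is the head, since \<open>M\<close> is a model,
  and the bounds on \<open>Ls\<close> resume.\<close>

lemma clause_resolvent_bounded:
  assumes "acceptable \<Sigma> P lev M" "extends P R" "is_model M (P \<union> R)"
    and "clause_resolvent \<Sigma> (P \<union> R) Q Q'" "bounded_query \<Sigma> P lev M k Q"
  shows "bounded_query \<Sigma> P lev M k Q'"
  using assms(4)
proof (rule clause_resolventE)
  fix A Ls C \<theta> \<tau>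
  assume Q: "Q = Pos A # Ls" and C: "C \<in> P \<union> R" and wf: "wf_subst \<Sigma> \<theta>" "wf_subst \<Sigma> \<tau>"
    and eq: "subst_atom \<theta> A = subst_atom \<tau> (head C)"
    and Q': "Q' = subst_query \<tau> (body C) @ subst_query \<theta> Ls"
  show ?thesis unfolding bounded_query_def
  proof (intro allI impI)
    fix \<sigma> assume \<sigma>: "ground_subst \<Sigma> \<sigma>"
    let ?\<theta> = "subst_comp \<sigma> \<theta>" and ?\<tau> = "subst_comp \<sigma> \<tau>"
    have gr: "ground_subst \<Sigma> ?\<theta>" "ground_subst \<Sigma> ?\<tau>" using \<sigma> wf by (auto intro: ground_subst_comp)
    have eq': "subst_atom ?\<theta> A = subst_atom ?\<tau> (head C)"
      using eq by (metis subst_atom_subst_atom)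
    have chn: "chain (valid M) (level_below P lev k) (subst_query ?\<theta> Q)"
      using assms(5) gr by (simp add: bounded_query_def)
    then have "level_below P lev (Suc k) (Pos (subst_atom ?\<tau> (head C)))"
      \<comment> \<open>The bound \<open>k\<close> on the head is weakened to \<open>Suc k\<close>
        only to fit \<open>body_level_below\<close>; the body is again bounded by
        \<open>k\<close>.\<close>
      using eq' Q by (intro level_below_Suc) simp
    then have body: "chain (valid M) (level_below P lev k) (subst_query ?\<tau> (body C))"
      using body_level_below[OF assms(1,2) C gr(2)] by blast
    have "valid M (Pos (subst_atom ?\<theta> A))" if "\<forall>L \<in> set (subst_query ?\<tau> (body C)). valid M L"
    proof
      fix v
      have "sat_query M v (subst_query ?\<tau> (body C))" using that by (simp add: sat_query_def)
      then show "sat_literal M v (Pos (subst_atom ?\<theta> A))"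
        unfolding eq' using assms(3) C by (auto simp: is_model_def)
    qed
    with chn body show "chain (valid M) (level_below P lev k) (subst_query \<sigma> Q')"
      unfolding Q Q' by (simp del: sat_subst_literal sat_subst_atom)
  qed
qed

text \<open>The resolvent of a single atom is just an instance of a clause body, so the bound drops
  by one. This drives the induction on \<open>k\<close>.\<close>

lemma clause_resolvent_bounded_decrease:
  assumes "acceptable \<Sigma> P lev M" "extends P R"
    and "clause_resolvent \<Sigma> (P \<union> R) [Pos A] Q'" "bounded_query \<Sigma> P lev M (Suc k) [Pos A]"
  shows "bounded_query \<Sigma> P lev M k Q'"
  using assms(3)
proof (rule clause_resolventE)
  fix A' Ls C \<theta> \<tau>
  assume "[Pos A] = Pos A' # Ls" and C: "C \<in> P \<union> R" and wf: "wf_subst \<Sigma> \<theta>" "wf_subst \<Sigma> \<tau>"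
    and "subst_atom \<theta> A' = subst_atom \<tau> (head C)"
    and "Q' = subst_query \<tau> (body C) @ subst_query \<theta> Ls"
  then have eq: "subst_atom \<theta> A = subst_atom \<tau> (head C)" and Q': "Q' = subst_query \<tau> (body C)"
    by auto
  show ?thesis unfolding bounded_query_def
  proof (intro allI impI)
    fix \<sigma> assume \<sigma>: "ground_subst \<Sigma> \<sigma>"
    let ?\<theta> = "subst_comp \<sigma> \<theta>" and ?\<tau> = "subst_comp \<sigma> \<tau>"
    have gr: "ground_subst \<Sigma> ?\<theta>" "ground_subst \<Sigma> ?\<tau>" using \<sigma> wf by (auto intro: ground_subst_comp)
    have "level_below P lev (Suc k) (Pos (subst_atom ?\<theta> A))"
      using assms(4) gr(1) by (simp add: bounded_query_def)
    then have "level_below P lev (Suc k) (Pos (subst_atom ?\<tau> (head C)))"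
      using eq by (metis subst_atom_subst_atom)
    then show "chain (valid M) (level_below P lev k) (subst_query \<sigma> Q')"
      using body_level_below[OF assms(1,2) C gr(2)] Q' by simp
  qed
qed

lemma finitely_failed_valid:
  assumes "complete_model \<Sigma> M P" "wf_program \<Sigma> P" "finitely_failed \<Sigma> P [Pos A]" "wf_atom \<Sigma> A"
    and "pred A \<in> neg_rels P"
  shows "valid M (Neg A)"
  using ldnf_tree_sound[OF assms(1,2), of "[Pos A]" "{Failure}"] assms subsetD[OF neg_rels_subset_star assms(5)]
  by (auto simp: finitely_failed_def)

lemma resolvent_Neg_bounded:
  assumes "bounded_query \<Sigma> P lev M k (Neg A # Ls)" "valid M (Neg A)"
  shows "bounded_query \<Sigma> P lev M k Ls"
  using assms by (auto simp: bounded_query_def)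

text \<open>\<open>k\<close> is a strict upper bound of the finite set of levels.\<close>

lemma bounded_atom_query:
  assumes "pred A \<in> defined_rels P \<longrightarrow> bounded_atom \<Sigma> lev A"
  shows "\<exists>k. bounded_query \<Sigma> P lev M k [Pos A]"
proof (cases "pred A \<in> defined_rels P")
  case True
  let ?B = "{lev A' |A'. ground_instance \<Sigma> A' A}"
  obtain k where k: "\<forall>l \<in> ?B. l < k"
    using assms True finite_nat_set_iff_bounded[of ?B] by (auto simp: bounded_atom_def)
  have "lev (subst_atom \<sigma> A) < k" if "ground_subst \<Sigma> \<sigma>" for \<sigma>
  proof -
    have "ground_instance \<Sigma> (subst_atom \<sigma> A) A"
      using that by (auto simp: ground_instance_def ground_subst_def vars_subst_atom)
    then show ?thesis using k by blast
  qed
  then show ?thesis by (auto simp: bounded_query_def level_below_def)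
qed (auto simp: bounded_query_def level_below_def)

theorem corollary35:
  fixes \<Sigma> :: "('f, 'p) signature"
    and m :: "'p \<Rightarrow> nat \<Rightarrow> mode"
    and ty :: "'p \<Rightarrow> nat \<Rightarrow> 'f trm set"
    and P R :: "('f, 'p) program"
    and M :: "('f, 'p, 'd) interp"
    and lev :: "('f, 'p) level_mapping"
  assumes "has_constant \<Sigma>"
    and "type_assignment \<Sigma> ty"
    and "wf_program \<Sigma> P" and "wf_program \<Sigma> R"
    and "well_typed_program \<Sigma> m ty (P \<union> R)"
    and "extends P R"
    and "complete_model \<Sigma> M (P \<union> R)"
    and "acceptable \<Sigma> P lev M"
    and "\<And>A. \<lbrakk>wf_atom \<Sigma> A; well_typed_query \<Sigma> m ty [Pos A]; pred A \<in> defined_rels P\<rbrakk>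
           \<Longrightarrow> bounded_atom \<Sigma> lev A"
    and "\<And>Q. \<lbrakk>wf_query \<Sigma> Q; well_typed_query \<Sigma> m ty Q\<rbrakk> \<Longrightarrow> all_derivations_finite \<Sigma> R Q"
  shows "\<forall>Q. wf_query \<Sigma> Q \<and> well_typed_query \<Sigma> m ty Q \<longrightarrow> all_derivations_finite \<Sigma> (P \<union> R) Q"
proof -
  let ?T = "terminating \<Sigma> (P \<union> R)" and ?bounded = "bounded_query \<Sigma> P lev M"
  \<comment> \<open>Finite failure is sound only for relations in \<open>neg_rels_star\<close>. This
    condition holds for all negative literals stemming from clauses, but possibly not for those of
    the given query.\<close>
  let ?neg = "\<lambda>Q. \<forall>A. Neg A \<in> set Q \<longrightarrow> pred A \<in> neg_rels (P \<union> R)"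
  define wt where "wt Q \<longleftrightarrow> wf_query \<Sigma> Q \<and> well_typed_query \<Sigma> m ty Q" for Q
  have wf: "wf_program \<Sigma> (P \<union> R)" using assms(3,4) by (auto simp: wf_program_def)
  have model: "is_model M (P \<union> R)" using assms(7) by (simp add: complete_model_def)
  have wt_resolvent: "wt Q'" if "wt Q" "resolvent \<Sigma> (P \<union> R) Q Q'" for Q Q'
    using that(2)
  proof cases
    case 1
    then show ?thesis
      using that(1) clause_resolvent_wf[OF wf] clause_resolvent_well_typed[OF assms(5)]
      by (auto simp: wt_def)
  next
    case (2 A)
    then show ?thesis using that(1) well_typed_query_Neg(1) by (auto simp: wt_def)
  qed
  have wt_hd: "wt [Pos (atom_of L)]" if "wt (L # Ls)" for L Ls
    using that well_typed_query_hd[of \<Sigma> m ty L Ls] well_typed_query_Neg(2)[of \<Sigma> m ty "atom_of L"]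
    by (cases L) (auto simp: wt_def)
  have bounded_atoms: "?T [Pos A]" if "wt [Pos A]" "?bounded k [Pos A]" for k A
    using that
  proof (induction k arbitrary: A)
    case 0
    \<comment> \<open>Level below 0 is impossible, so the atom is not defined in \<open>P\<close>. A
      ground substitution is required here, as otherwise the bound would hold vacuously.\<close>
    obtain \<sigma> where "ground_subst \<Sigma> \<sigma>" using ex_ground_subst[OF assms(1)] by blast
    with 0 have "pred A \<notin> defined_rels P"
      by (auto simp: bounded_query_def level_below_def)
    then show ?case
      using terminating_extends[OF assms(6), of \<Sigma> "[Pos A]"] 0 assms(10)[of "[Pos A]"]
      by (simp add: wt_def all_derivations_finite_iff_terminating)
  next
    case (Suc k)
    define I where "I Q \<longleftrightarrow> wt Q \<and> ?neg Q \<and> ?bounded k Q" for Q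
    have closed: "I Q'" if "I Q" and res: "resolvent \<Sigma> (P \<union> R) Q Q'" for Q Q'
      using res
    proof cases
      case 1
      then show ?thesis
        using that wt_resolvent[OF _ res] clause_resolvent_neg_preds[OF 1 order_refl]
          clause_resolvent_bounded[OF assms(8,6) model 1]
        by (simp add: I_def)
    next
      case (2 A)
      \<comment> \<open>The removed literal is true in \<open>M\<close>, so the bounds on the
        literals after it become available.\<close>
      then have "valid M (Neg A)"
        using that(1) by (intro finitely_failed_valid[OF assms(7) wf]) (auto simp: I_def wt_def)
      then have "?bounded k Q'" using that(1) 2 resolvent_Neg_bounded by (auto simp: I_def)
      then show ?thesis using that 2 wt_resolvent[OF _ res] by (auto simp: I_def)
    qed
    have hd: "?T [L]" if "I (L # Ls)" for L Ls
    proof -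
      have "?bounded k [Pos (atom_of L)]"
        using that by (auto simp: I_def bounded_query_def level_below_def)
      then have "?T [Pos (atom_of L)]" using Suc.IH wt_hd[of L Ls] that by (simp add: I_def)
      then show ?thesis using terminating_NegI by (cases L) auto
    qed
    show ?case
    proof (rule terminatingI)
      fix Q' assume res: "clause_resolvent \<Sigma> (P \<union> R) [Pos A] Q'"
      \<comment> \<open>\<open>[Pos A]\<close> has no negative literal, so all those of
        \<open>Q'\<close> come from the clause used and \<open>?neg\<close> holds.\<close>
      have "I Q'"
        using Suc.prems wt_resolvent[of "[Pos A]" Q'] res
          clause_resolvent_neg_preds[OF res order_refl]
          clause_resolvent_bounded_decrease[OF assms(8,6) res]
        by (auto simp: I_def intro: resolvent.intros)
      then show "?T Q'"
        by (rule terminating_if_heads_terminating[of I, rotated 2]) (fact closed, fact hd)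
    qed
  qed
  \<comment> \<open>For an arbitrary query the invariant is \<open>wt\<close> alone. Each selected
    atom gets its own bound \<open>k\<close>, so no common bound for the query is required.\<close>
  have hd: "?T [L]" if "wt (L # Ls)" for L Ls
  proof -
    have wt_atom: "wt [Pos (atom_of L)]" using wt_hd[OF that] .
    then obtain k where "?bounded k [Pos (atom_of L)]"
      using bounded_atom_query[of "atom_of L" P \<Sigma> lev] assms(9)[of "atom_of L"]
      by (auto simp: wt_def)
    then have "?T [Pos (atom_of L)]" using bounded_atoms wt_atom by blast
    then show ?thesis using terminating_NegI by (cases L) auto
  qed
  have "?T Q" if "wt Q" for Q
    using that by (rule terminating_if_heads_terminating[of wt, rotated 2]) (fact wt_resolvent, fact hd)
  then show ?thesis by (simp add: wt_def all_derivations_finite_iff_terminating)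
qed

end
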